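(* Let $\Bbbk\in\{\mathbb{R},\mathbb{C},\mathbb{H},\mathbb{O}\}$ be a real Hurwitz algebra and let $n\geq 2$, with $n=3$ if $\Bbbk=\mathbb{O}$. The sectional nonassociativity of the deunitalization $(\mathrm{Herm}_0(n,\Bbbk),\circ,h)$ of the rank $n$ simple Euclidean Jordan algebra $\mathrm{Herm}(n,\Bbbk)$ satisfies $$-1\leq\mathscr{K}(x,y)\leq\tfrac{n-2}{2}$$ for all linearly independent $x,y\in\mathrm{Herm}_0(n,\Bbbk)$, and both bounds are attained. If $\Bbbk$ is associative, the associator is given by $$[x,y,z]_\circ=\tfrac14[y,[x,z]]-h(x,y)z+h(y,z)x$$ for all $x,y,z\in\mathrm{Herm}_0(n,\Bbbk)$.
   Context: $\mathrm{Herm}(n,\Bbbk)$ is the real vector space of $n\times n$ matrices $x$ over $\Bbbk$ with $\bar x^t=x$, where $\bar{\ }$ is the standard conjugation of $\Bbbk$ (trivial for $\mathbb{R}$), with Jordan product $x\star y=\tfrac12(xy+yx)$ (juxtaposition is the matrix product). Its deunitalization is $\mathrm{Herm}_0(n,\Bbbk)=\{x\in\mathrm{Herm}(n,\Bbbk):\operatorname{tr}x=0\}$, with multiplication $x\circ y=x\star y-\tfrac1n\operatorname{tr}(x\star y)I$, where $I$ is the identity matrix, and positive definite metric $h(x,y)=\tfrac1n\operatorname{tr}(x\star y)$. The associator is $[x,y,z]_\circ=(x\circ y)\circ z-x\circ(y\circ z)$, and $[x,y]=xy-yx$ is the matrix commutator. For linearly independent $x,y$, $$\mathscr{K}(x,y)=\frac{h(x\circ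 x,y\circ y)-h(x\circ y,x\circ y)}{h(x,x)h(y,y)-h(x,y)^2}.$$
   Formalization: The lower bound -1 is claimed to be attained only for n ≥ 3: for n = 2 the product ∘ vanishes identically, so K(x,y) = 0 for all linearly independent x, y and -1 is not attained. *)

theory Defs
  imports "HOL-Analysis.Analysis"
begin

text \<open>Multiplication is neither assumed associative nor commutative, so that the octonions
  are an instance; this is also why \<^class>\<open>real_algebra_1\<close> cannot be used.  The operation
  \<open>hre\<close> is the real part, determined by \<open>a + hconj a = 2 hre(a) 1\<close>.\<close>

class conj_algebra = real_vector + times + one +
  fixes hconj :: "'a \<Rightarrow> 'a"
    and hre :: "'a \<Rightarrow> real"
  assumes hmult_add_left: "(a + b) * c = a * c + b * c"
    and hmult_add_right: "a * (b + c) = a * b + a * c"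
    and hmult_scaleR_left: "(r *\<^sub>R a) * b = r *\<^sub>R (a * b)"
    and hmult_scaleR_right: "a * (r *\<^sub>R b) = r *\<^sub>R (a * b)"
    and hmult_one_left: "1 * a = a"
    and hmult_one_right: "a * 1 = a"
    and hone_neq_zero: "1 \<noteq> 0"
    and hconj_add: "hconj (a + b) = hconj a + hconj b"
    and hconj_scaleR: "hconj (r *\<^sub>R a) = r *\<^sub>R hconj a"
    and hconj_hconj: "hconj (hconj a) = a"
    and hconj_mult: "hconj (a * b) = hconj b * hconj a"
    and hconj_one: "hconj 1 = 1"
    and add_hconj: "a + hconj a = (2 * hre a) *\<^sub>R 1"

lemma hmult_zero_left:
  fixes a :: "'a::conj_algebra"
  shows "0 * a = 0"
  using hmult_scaleR_left[of 0 "0::'a" a] by simp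

lemma hmult_zero_right:
  fixes a :: "'a::conj_algebra"
  shows "a * 0 = 0"
  using hmult_scaleR_right[of a 0 "0::'a"] by simp

lemma hconj_zero:
  "hconj (0 :: 'a::conj_algebra) = 0"
  using hconj_scaleR[of 0 "0::'a"] by simp

lemma hconj_minus:
  fixes a :: "'a::conj_algebra"
  shows "hconj (- a) = - hconj a"
  using hconj_scaleR[of "-1" a] by simp

lemma hmult_minus_left:
  fixes a b :: "'a::conj_algebra"
  shows "(- a) * b = - (a * b)"
  using hmult_scaleR_left[of "-1" a b] by simp

lemma hmult_minus_right:
  fixes a b :: "'a::conj_algebra"
  shows "a * (- b) = - (a * b)"
  using hmult_scaleR_right[of a "-1" b] by simp

lemma hconj_diff:
  fixes a b :: "'a::conj_algebra"
  shows "hconj (a - b) = hconj a - hconj b"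
  using hconj_add[of a "- b"] by (simp add: hconj_minus)

lemma hmult_diff_left:
  fixes a b c :: "'a::conj_algebra"
  shows "(a - b) * c = a * c - b * c"
  using hmult_add_left[of a "- b" c] by (simp add: hmult_minus_left)

lemma hmult_diff_right:
  fixes a b c :: "'a::conj_algebra"
  shows "a * (b - c) = a * b - a * c"
  using hmult_add_right[of a b "- c"] by (simp add: hmult_minus_right)

instantiation real :: conj_algebra
begin
definition hconj_real :: "real \<Rightarrow> real" where "hconj_real a = a"
definition hre_real :: "real \<Rightarrow> real" where "hre_real a = a"
instance
  by standard (simp_all add: hconj_real_def hre_real_def algebra_simps)
end

instantiation complex :: conj_algebra
begin
definition hconj_complex :: "complex \<Rightarrow> complex" where "hconj_complex = cnj"
definition hre_complex :: "complex \<Rightarrow> real" where "hre_complex = Re"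
instance
  by standard (simp_all add: hconj_complex_def hre_complex_def algebra_simps complex_eq_iff)
end

text \<open>\<open>CD a b\<close> stands for \<open>a + b j\<close>; doubling \<^typ>\<open>complex\<close> once gives the
  quaternions and twice the octonions.\<close>

datatype 'a cayley_dickson = CD (cd_fst: 'a) (cd_snd: 'a)

instantiation cayley_dickson :: (conj_algebra) conj_algebra
begin

definition zero_cayley_dickson :: "'a cayley_dickson" where
  "0 = CD 0 0"

definition one_cayley_dickson :: "'a cayley_dickson" where
  "1 = CD 1 0"

definition plus_cayley_dickson :: "'a cayley_dickson \<Rightarrow> 'a cayley_dickson \<Rightarrow> 'a cayley_dickson" where
  "p + q = CD (cd_fst p + cd_fst q) (cd_snd p + cd_snd q)"

definition minus_cayley_dickson :: "'a cayley_dickson \<Rightarrow> 'a cayley_dickson \<Rightarrow> 'a cayley_dickson" where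
  "p - q = CD (cd_fst p - cd_fst q) (cd_snd p - cd_snd q)"

definition uminus_cayley_dickson :: "'a cayley_dickson \<Rightarrow> 'a cayley_dickson" where
  "- p = CD (- cd_fst p) (- cd_snd p)"

definition scaleR_cayley_dickson :: "real \<Rightarrow> 'a cayley_dickson \<Rightarrow> 'a cayley_dickson" where
  "r *\<^sub>R p = CD (r *\<^sub>R cd_fst p) (r *\<^sub>R cd_snd p)"

definition times_cayley_dickson :: "'a cayley_dickson \<Rightarrow> 'a cayley_dickson \<Rightarrow> 'a cayley_dickson" where
  "p * q = CD (cd_fst p * cd_fst q - hconj (cd_snd q) * cd_snd p)
              (cd_snd q * cd_fst p + cd_snd p * hconj (cd_fst q))"

definition hconj_cayley_dickson :: "'a cayley_dickson \<Rightarrow> 'a cayley_dickson" where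
  "hconj p = CD (hconj (cd_fst p)) (- cd_snd p)"

definition hre_cayley_dickson :: "'a cayley_dickson \<Rightarrow> real" where
  "hre p = hre (cd_fst p)"

lemmas cd_defs = zero_cayley_dickson_def one_cayley_dickson_def plus_cayley_dickson_def
  minus_cayley_dickson_def uminus_cayley_dickson_def scaleR_cayley_dickson_def
  times_cayley_dickson_def hconj_cayley_dickson_def hre_cayley_dickson_def

instance
  by standard
    (simp_all add: cd_defs hmult_add_left hmult_add_right hmult_diff_left hmult_diff_right
      hmult_scaleR_left hmult_scaleR_right hmult_one_left hmult_one_right hmult_zero_left
      hmult_zero_right hmult_minus_left hmult_minus_right hone_neq_zero hconj_add hconj_scaleR
      hconj_hconj hconj_mult hconj_one hconj_zero hconj_minus hconj_diff add_hconj
      scaleR_add_left scaleR_add_right scaleR_diff_right add_ac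
      cayley_dickson.expand algebra_simps)

end

type_synonym quaternion = "complex cayley_dickson"
type_synonym octonion = "quaternion cayley_dickson"

definition conj_algebra_isomorphic :: "'a::conj_algebra itself \<Rightarrow> 'b::conj_algebra itself \<Rightarrow> bool" where
  "conj_algebra_isomorphic A B \<longleftrightarrow>
     (\<exists>f :: 'a \<Rightarrow> 'b. linear f \<and> bij f \<and> f 1 = 1 \<and> (\<forall>a b. f (a * b) = f a * f b) \<and>
        (\<forall>a. f (hconj a) = hconj (f a)))"

definition associator :: "('v::real_vector \<Rightarrow> 'v \<Rightarrow> 'v) \<Rightarrow> 'v \<Rightarrow> 'v \<Rightarrow> 'v \<Rightarrow> 'v" where
  "associator m x y z = m (m x y) z - m x (m y z)"

definition sect_nonassoc ::
    "('v::real_vector \<Rightarrow> 'v \<Rightarrow> 'v) \<Rightarrow> ('v \<Rightarrow> 'v \<Rightarrow> real) \<Rightarrow> 'v \<Rightarrow> 'v \<Rightarrow> real" where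
  "sect_nonassoc m h x y =
     (h (m x x) (m y y) - h (m x y) (m x y)) / (h x x * h y y - (h x y)\<^sup>2)"

text \<open>The library's matrix product and trace require a \<^class>\<open>semiring_1\<close>, which excludes the
  octonions.\<close>

definition mprod :: "'k::conj_algebra^'n^'n \<Rightarrow> 'k^'n^'n \<Rightarrow> 'k^'n^'n" where
  "mprod x y = (\<chi> i j. \<Sum>l\<in>UNIV. x $ i $ l * y $ l $ j)"

definition mtrace :: "'k::conj_algebra^'n^'n \<Rightarrow> 'k" where
  "mtrace x = (\<Sum>i\<in>UNIV. x $ i $ i)"

definition mconj :: "'k::conj_algebra^'n^'n \<Rightarrow> 'k^'n^'n" where
  "mconj x = (\<chi> i j. hconj (x $ i $ j))"

definition mcommutator :: "'k::conj_algebra^'n^'n \<Rightarrow> 'k^'n^'n \<Rightarrow> 'k^'n^'n" where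
  "mcommutator x y = mprod x y - mprod y x"

definition Herm :: "('k::conj_algebra^'n^'n) set" where
  "Herm = {x. transpose (mconj x) = x}"

definition Herm0 :: "('k::conj_algebra^'n^'n) set" where
  "Herm0 = {x \<in> Herm. mtrace x = 0}"

definition jordan_prod :: "'k::conj_algebra^'n^'n \<Rightarrow> 'k^'n^'n \<Rightarrow> 'k^'n^'n" where
  "jordan_prod x y = (1/2) *\<^sub>R (mprod x y + mprod y x)"

definition herm_circ :: "'k::conj_algebra^'n^'n \<Rightarrow> 'k^'n^'n \<Rightarrow> 'k^'n^'n" where
  "herm_circ x y = jordan_prod x y - (1 / real CARD('n)) *\<^sub>R mat (mtrace (jordan_prod x y))"

text \<open>For Hermitian \<open>x\<close> and \<open>y\<close> the trace of their Jordan product is a real multiple of \<open>1\<close>;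
  \<^const>\<open>hre\<close> turns it into the corresponding real number.\<close>

definition herm_metric :: "'k::conj_algebra^'n^'n \<Rightarrow> 'k^'n^'n \<Rightarrow> real" where
  "herm_metric x y = (1 / real CARD('n)) * hre (mtrace (jordan_prod x y))"

definition herm_sect :: "'k::conj_algebra^'n^'n \<Rightarrow> 'k^'n^'n \<Rightarrow> real" where
  "herm_sect = sect_nonassoc herm_circ herm_metric"

definition lin_indep_pair :: "'v::real_vector \<Rightarrow> 'v \<Rightarrow> bool" where
  "lin_indep_pair x y \<longleftrightarrow> x \<noteq> y \<and> independent {x, y}"

end

theory Submission
  imports Defs
begin

text \<open>Let \<open>\<langle>x, y\<rangle>\<close> be the unnormalised trace form \<open>minner\<close>,
\<open>jordan_defect x y = \<langle>x \<star> x, y \<star> y\<rangle> - |x \<star> y|\<^sup>2\<close> and \<open>gram_det x y = |x|\<^sup>2 |y|\<^sup>2 - \<langle>x, y\<rangle>\<^sup>2\<close>.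
Replacing \<open>\<star>\<close> by the product \<open>\<circ>\<close> subtracts multiples of the identity matrix, and the effect on
the sectional nonassociativity is that \<open>K(x, y) = n jordan_defect x y / gram_det x y - 1\<close>
(\<open>herm_sect_eq\<close>). Both bounds together therefore say \<open>0 \<le> 2 jordan_defect x y \<le> gram_det x y\<close>.
For associative scalars the defect is a quarter of the squared norm of the commutator, and the
upper bound is the Boettcher--Wenzel inequality for Hermitian matrices; the argument below
treats associative and octonionic scalars alike.

If \<open>x\<close> is diagonal with real entries \<open>e\<^sub>i\<close>, the defect is \<open>\<Sum>\<^sub>i\<^sub>j (e\<^sub>i - e\<^sub>j)\<^sup>2/4 |y\<^sub>i\<^sub>j|\<^sup>2\<close>
(\<open>jordan_defect_diagonal\<close>). This is visibly nonnegative, and \<open>(e\<^sub>i - e\<^sub>j)\<^sup>2 \<le> 2 |x|\<^sup>2\<close> gives the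
upper bound. The general case is reduced to this one by maps preserving Jordan product and
trace, hence both sides of the inequalities. A spectral theorem is replaced by Jacobi's
eigenvalue method: a phase transformation makes a large off-diagonal entry real
(\<open>make_entry_real\<close>), a plane rotation then annihilates it (\<open>annihilate_real_entry\<close>), and each
such step shrinks the off-diagonal part by a fixed factor. So \<open>x\<close> becomes as nearly diagonal as
desired, and since the two inequalities are continuous they survive in the limit
(\<open>jordan_defect_bounds\<close>).

The scalars enter through alternativity and positivity of the norm, and decisively through the
phases: over associative scalars conjugation by a diagonal matrix of unit scalars is an
automorphism, while for \<open>n = 3\<close> over the octonions the phases \<open>(u, 1, u\<^sup>*)\<close> act by Jordan
automorphisms because of the three Moufang identities, each of which settles two of the six
orders in which the three phases can meet in a product.

Equality holds for independent diagonal pairs (lower bound) and for \<open>E\<^sub>p\<^sub>p - E\<^sub>q\<^sub>q\<close>,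
\<open>E\<^sub>p\<^sub>q + E\<^sub>q\<^sub>p\<close> (upper bound). The associator formula is the classical identity
\<open>(x \<star> y) \<star> z - x \<star> (y \<star> z) = 1/4 [y, [x, z]]\<close> together with the trace corrections.\<close>

section \<open>Conjugation algebras\<close>

lemma hre_eqI: assumes "(a *\<^sub>R (1::'k::conj_algebra)) = b *\<^sub>R 1" shows "a = b"
  using assms hone_neq_zero by (metis scaleR_cancel_right)

lemma hre_add: "hre (a + b :: 'k::conj_algebra) = hre a + hre b"
proof -
  have "(2 * hre (a + b)) *\<^sub>R (1::'k) = (2 * hre a + 2 * hre b) *\<^sub>R 1"
    by (simp add: scaleR_add_left add_hconj[symmetric] hconj_add add_ac)
  from hre_eqI[OF this] show ?thesis by simp
qed

lemma hre_scaleR: "hre (r *\<^sub>R a :: 'k::conj_algebra) = r * hre a"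
proof -
  have "(2 * hre (r *\<^sub>R a)) *\<^sub>R (1::'k) = r *\<^sub>R (a + hconj a)"
    by (simp only: add_hconj[symmetric] hconj_scaleR scaleR_add_right)
  also have "\<dots> = (r * (2 * hre a)) *\<^sub>R 1" by (simp add: add_hconj)
  finally show ?thesis using hre_eqI by fastforce
qed

lemma hre_zero: "hre (0::'k::conj_algebra) = 0"
  using hre_scaleR[of 0 "0::'k"] by simp

lemma hre_minus: "hre (- a :: 'k::conj_algebra) = - hre a"
  using hre_scaleR[of "-1" a] by simp

lemma hre_diff: "hre (a - b :: 'k::conj_algebra) = hre a - hre b"
  using hre_add[of a "- b"] by (simp add: hre_minus)

lemma hre_one: "hre (1::'k::conj_algebra) = 1"
proof -
  have "(2 * hre (1::'k)) *\<^sub>R (1::'k) = 2 *\<^sub>R 1"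
    by (simp add: add_hconj[symmetric] hconj_one scaleR_2)
  from hre_eqI[OF this] show ?thesis by simp
qed

lemma hre_hconj: "hre (hconj a :: 'k::conj_algebra) = hre a"
proof -
  have "(2 * hre (hconj a)) *\<^sub>R (1::'k) = (2 * hre a) *\<^sub>R 1"
    by (simp only: add_hconj[symmetric] hconj_hconj add.commute)
  from hre_eqI[OF this] show ?thesis by simp
qed

lemma hre_sum: "hre (\<Sum>i\<in>I. f i :: 'k::conj_algebra) = (\<Sum>i\<in>I. hre (f i))"
  by (induction I rule: infinite_finite_induct) (simp_all add: hre_zero hre_add)

lemma hconj_sum: "hconj (\<Sum>i\<in>I. f i :: 'k::conj_algebra) = (\<Sum>i\<in>I. hconj (f i))"
  by (induction I rule: infinite_finite_induct) (simp_all add: hconj_zero hconj_add)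

lemma hmult_sum_left: "(\<Sum>i\<in>I. f i) * (b :: 'k::conj_algebra) = (\<Sum>i\<in>I. f i * b)"
  by (induction I rule: infinite_finite_induct) (simp_all add: hmult_zero_left hmult_add_left)

lemma hmult_sum_right: "(b :: 'k::conj_algebra) * (\<Sum>i\<in>I. f i) = (\<Sum>i\<in>I. b * f i)"
  by (induction I rule: infinite_finite_induct) (simp_all add: hmult_zero_right hmult_add_right)

text \<open>The conjugate is an affine function of the element; identities involving conjugates thus reduce
to identities in the elements themselves.\<close>

lemma hconj_eq: "hconj a = (2 * hre a) *\<^sub>R 1 - (a :: 'k::conj_algebra)"
  using add_hconj[of a] by (simp add: algebra_simps)

lemma hconj_fixed_eq: assumes "hconj a = (a :: 'k::conj_algebra)" shows "a = hre a *\<^sub>R 1"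
proof -
  have "2 *\<^sub>R a = 2 *\<^sub>R (hre a *\<^sub>R 1)" using add_hconj[of a] assms by (simp add: scaleR_2)
  then show ?thesis by (simp only: scaleR_cancel_left) simp
qed

lemma hre_mult_commute: "hre (a * b) = hre (b * a :: 'k::conj_algebra)"
proof -
  have "hre (a * b) = hre (hconj b * hconj a)"
    by (metis hre_hconj hconj_mult)
  also have "\<dots> = hre (b * a)"
    by (simp add: hconj_eq[of a] hconj_eq[of b] hmult_diff_left hmult_diff_right hmult_scaleR_left
        hmult_scaleR_right hmult_one_left hmult_one_right hre_diff hre_scaleR hre_one)
  finally show ?thesis .
qed

definition hinner :: "'k::conj_algebra \<Rightarrow> 'k \<Rightarrow> real" where
  "hinner a b = hre (a * hconj b)"

lemma hinner_commute: "hinner a b = hinner b a"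
  unfolding hinner_def by (metis hre_hconj hconj_mult hconj_hconj)

lemma hinner_add_left: "hinner (a + b) c = hinner a c + hinner b c"
  by (simp add: hinner_def hmult_add_left hre_add)

lemma hinner_scaleR_left: "hinner (r *\<^sub>R a) c = r * hinner a c"
  by (simp add: hinner_def hmult_scaleR_left hre_scaleR)

lemma hinner_add_right: "hinner c (a + b) = hinner c a + hinner c b"
  by (metis hinner_commute hinner_add_left)

lemma hinner_scaleR_right: "hinner c (r *\<^sub>R a) = r * hinner c a"
  by (metis hinner_commute hinner_scaleR_left)

lemma hinner_zero_left: "hinner 0 c = 0" 
  by (simp add: hinner_def hmult_zero_left hre_zero)

lemma hinner_zero_right: "hinner c 0 = 0" 
  by (metis hinner_commute hinner_zero_left)

lemma hinner_sum_left: "hinner (\<Sum>i\<in>I. f i) c = (\<Sum>i\<in>I. hinner (f i) c)"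
  by (simp add: hinner_def hmult_sum_left hre_sum)

lemma hinner_sum_right: "hinner c (\<Sum>i\<in>I. f i) = (\<Sum>i\<in>I. hinner c (f i))"
  by (simp add: hinner_commute[of c] hinner_sum_left)

lemma hinner_one_one: "hinner 1 (1::'k::conj_algebra) = 1"
  by (simp add: hinner_def hmult_one_left hconj_one hre_one)

lemma mult_hconj_self: "a * hconj a = hinner a a *\<^sub>R (1 :: 'k::conj_algebra)"
  unfolding hinner_def by (rule hconj_fixed_eq) (simp add: hconj_mult hconj_hconj)

lemma hconj_mult_self: "hconj a * a = hinner a a *\<^sub>R (1 :: 'k::conj_algebra)"
  unfolding mult_hconj_self[symmetric]
  by (simp add: hconj_eq hmult_diff_left hmult_diff_right hmult_scaleR_left
        hmult_scaleR_right hmult_one_left hmult_one_right)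

lemma hinner_hconj: "hinner (hconj a) (hconj b) = hinner a b"
  by (simp add: hinner_def hconj_hconj) (metis hre_mult_commute hinner_def hinner_commute)

section \<open>Alternative conjugation algebras\<close>

text \<open>The parameter is a type token: it allows the laws to be assumed for one type of scalars at a
time, without making that type an instance of a further class.\<close>

locale alternative_conj_algebra =
  fixes algebra_type :: "'k::conj_algebra itself"
  assumes left_alternative: "(a::'k) * (a * b) = (a * a) * b"
    and hinner_self_pos: "(a::'k) \<noteq> 0 \<Longrightarrow> hinner a a > 0"
begin

text \<open>Conjugation is an anti-automorphism, so it exchanges the two alternative laws.\<close>

lemma right_alternative: "(b * a) * a = b * (a * (a::'k))"
proof -
  have "hconj (hconj a * (hconj a * hconj b)) = hconj ((hconj a * hconj a) * hconj b)"
    by (simp only: left_alternative)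
  then show ?thesis by (simp add: hconj_mult hconj_hconj)
qed

abbreviation assoc3 :: "'k \<Rightarrow> 'k \<Rightarrow> 'k \<Rightarrow> 'k" where
  "assoc3 \<equiv> associator (*)"

lemma assoc3_swap12: "assoc3 a b c = - assoc3 b a c"
  using left_alternative[of "a + b" c] left_alternative[of a c] left_alternative[of b c]
  by (simp add: associator_def hmult_add_left hmult_add_right algebra_simps)

lemma assoc3_swap23: "assoc3 a b c = - assoc3 a c b"
  using right_alternative[of a "b + c"] right_alternative[of a b] right_alternative[of a c]
  by (simp add: associator_def hmult_add_left hmult_add_right algebra_simps)

lemma assoc3_swap13: "assoc3 a b c = - assoc3 c b a"
  using assoc3_swap12[of a b c] assoc3_swap23[of b a c] assoc3_swap12[of b c a] by simp

lemma flexible: "(a * b) * a = a * (b * (a::'k))"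
proof -
  have "assoc3 a b a = - assoc3 a a b" by (rule assoc3_swap23)
  also have "\<dots> = 0" by (simp add: associator_def left_alternative)
  finally show ?thesis by (simp add: associator_def)
qed

lemma flexible_hconj: "(a * b) * hconj a = a * (b * hconj (a::'k))"
  by (simp add: hconj_eq[of a] hmult_diff_left hmult_diff_right hmult_scaleR_left
        hmult_scaleR_right hmult_one_left hmult_one_right flexible)

lemma hconj_mult_cancel_left: "hconj a * (a * b) = hinner a a *\<^sub>R (b::'k)"
proof -
  have "hconj a * (a * b) = (hconj a * a) * b"
    by (simp add: hconj_eq[of a] hmult_diff_left hmult_diff_right hmult_scaleR_left
        hmult_scaleR_right hmult_one_left hmult_one_right left_alternative)
  then show ?thesis by (simp add: hconj_mult_self hmult_scaleR_left hmult_one_left)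
qed

lemma mult_hconj_cancel_right: "(b * a) * hconj a = hinner a a *\<^sub>R (b::'k)"
proof -
  have "(b * a) * hconj a = b * (a * hconj a)"
    by (simp add: hconj_eq[of a] hmult_diff_left hmult_diff_right hmult_scaleR_left
        hmult_scaleR_right hmult_one_left hmult_one_right right_alternative)
  then show ?thesis by (simp add: mult_hconj_self hmult_scaleR_right hmult_one_right)
qed

text \<open>Conjugation reverses the arguments of an associator, negates each of the three modulo real
multiples of \<open>1\<close>, and exchanges the two bracketings; in total the sign is unchanged. Reversal
alone changes the sign, so an associator is minus its own conjugate.\<close>

lemma hre_assoc: "hre ((a * b) * c) = hre (a * (b * (c::'k)))"
proof -
  have "hre (assoc3 a b c) = hre (hconj (assoc3 a b c))" by (simp add: hre_hconj)
  also have "hconj (assoc3 a b c) = - assoc3 (hconj c) (hconj b) (hconj a)"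
    by (simp add: associator_def hconj_diff hconj_mult)
  also have "\<dots> = assoc3 c b a"
    by (simp add: associator_def hconj_eq[of a] hconj_eq[of b] hconj_eq[of c] hmult_diff_left
        hmult_diff_right hmult_scaleR_left hmult_scaleR_right hmult_one_left hmult_one_right
        hmult_add_left hmult_add_right algebra_simps)
  also have "\<dots> = - assoc3 a b c" by (rule assoc3_swap13)
  finally have "hre (assoc3 a b c) = 0" by (simp add: hre_minus)
  then show ?thesis by (simp add: associator_def hre_diff)
qed

text \<open>Both sides differ by two associators, which alternativity lets one expand back into terms where
the repeated factor stands first.\<close>

lemma moufang_left: "((a * b) * a) * c = a * (b * (a * (c::'k)))"
proof -
  have "((a * b) * a) * c - a * (b * (a * c)) = assoc3 (a * b) a c + assoc3 a b (a * c)"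
    by (simp add: associator_def)
  also have "\<dots> = - assoc3 a (a * b) c - assoc3 a (a * c) b"
    using assoc3_swap12[of "a * b" a c] assoc3_swap23[of a b "a * c"] by simp
  also have "\<dots> = a * (assoc3 a b c + assoc3 a c b) - assoc3 (a * a) b c - assoc3 (a * a) c b"
    by (simp add: associator_def hmult_diff_left hmult_diff_right hmult_add_right left_alternative)
  also have "\<dots> = 0" using assoc3_swap23[of a b c] assoc3_swap23[of "a * a" b c]
    by (simp add: hmult_zero_right)
  finally show ?thesis by simp
qed

lemma moufang_right: "c * ((a * b) * a) = ((c * a) * b) * (a::'k)"
proof -
  have "hconj (((hconj a * hconj b) * hconj a) * hconj c)
      = hconj (hconj a * (hconj b * (hconj a * hconj c)))"
    by (simp only: moufang_left)
  then show ?thesis by (simp add: hconj_mult hconj_hconj flexible)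
qed

lemma moufang_middle: "(a * b) * (c * a) = (a * (b * c)) * (a::'k)"
proof -
  have "assoc3 a b (c * a) = - assoc3 a (c * a) b" by (rule assoc3_swap23)
  also have "\<dots> = a * assoc3 c a b"
    using moufang_left[of a c b] by (simp add: associator_def hmult_diff_right flexible)
  also have "assoc3 c a b = assoc3 b c a"
    using assoc3_swap12[of c a b] assoc3_swap13[of a c b] by simp
  finally show ?thesis unfolding flexible by (simp add: associator_def hmult_diff_right)
qed

lemma hinner_self_nonneg: "hinner a (a::'k) \<ge> 0"
  using hinner_self_pos[of a] by (cases "a = 0") (auto simp: hinner_zero_left)

text \<open>For \<open>a = b\<close> this is the composition law of the norm.\<close>

lemma hinner_mult_left: "hinner (u * a) (u * b) = hinner u u * hinner a (b::'k)"
proof -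
  have "hinner (u * a) (u * b) = hre ((u * a) * (hconj b * hconj u))"
    by (simp add: hinner_def hconj_mult)
  also have "\<dots> = hre (((u * a) * hconj b) * hconj u)" by (rule hre_assoc[symmetric])
  also have "\<dots> = hre (hconj u * ((u * a) * hconj b))" by (rule hre_mult_commute)
  also have "\<dots> = hre ((hconj u * (u * a)) * hconj b)" by (rule hre_assoc[symmetric])
  finally show ?thesis by (simp add: hconj_mult_cancel_left hinner_def hmult_scaleR_left hre_scaleR)
qed

lemma hinner_mult_right: "hinner (a * u) (b * u) = hinner u u * hinner a (b::'k)"
proof -
  have "hinner (a * u) (b * u) = hinner (hconj u * hconj a) (hconj u * hconj b)"
    by (metis hinner_hconj hconj_mult)
  then show ?thesis by (simp add: hinner_mult_left hinner_hconj)
qed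

lemma hinner_mult_self: "hinner (a * b) (a * b) = hinner a a * hinner b (b::'k)"
  by (rule hinner_mult_left)

lemma hinner_le: "2 * hinner a b \<le> hinner a a + hinner b (b::'k)"
  using hinner_self_nonneg[of "a + (-1) *\<^sub>R b"] hinner_commute[of a b]
  by (simp only: hinner_add_left hinner_add_right hinner_scaleR_left hinner_scaleR_right)
     (simp add: algebra_simps)

lemma hinner_sum_self_le:
  fixes f :: "'i::finite \<Rightarrow> 'k"
  shows "hinner (\<Sum>l\<in>UNIV. f l) (\<Sum>l\<in>UNIV. f l) \<le> real CARD('i) * (\<Sum>l\<in>UNIV. hinner (f l) (f l))"
proof -
  have "2 * hinner (\<Sum>l\<in>UNIV. f l) (\<Sum>l\<in>UNIV. f l) = (\<Sum>l\<in>UNIV. \<Sum>m\<in>UNIV. 2 * hinner (f l) (f m))"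
    unfolding hinner_sum_left unfolding hinner_sum_right by (simp add: sum_distrib_left)
  also have "\<dots> \<le> (\<Sum>l\<in>UNIV. \<Sum>m\<in>UNIV. hinner (f l) (f l) + hinner (f m) (f m))"
    by (intro sum_mono hinner_le)
  also have "\<dots> = 2 * (real CARD('i) * (\<Sum>l\<in>UNIV. hinner (f l) (f l)))"
    by (simp add: sum.distrib sum_distrib_left)
  finally show ?thesis by simp
qed

end

section \<open>Hermitian matrices and the trace form\<close>

lemma mprod_add_left: "mprod (x + y) z = mprod x z + mprod y z"
  by (simp add: mprod_def vec_eq_iff hmult_add_left sum.distrib)

lemma mprod_add_right: "mprod z (x + y) = mprod z x + mprod z y"
  by (simp add: mprod_def vec_eq_iff hmult_add_right sum.distrib)

lemma mprod_scaleR_left: "mprod (r *\<^sub>R x) y = r *\<^sub>R mprod x y"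
  by (simp add: mprod_def vec_eq_iff hmult_scaleR_left scaleR_right.sum)

lemma mprod_scaleR_right: "mprod x (r *\<^sub>R y) = r *\<^sub>R mprod x y"
  by (simp add: mprod_def vec_eq_iff hmult_scaleR_right scaleR_right.sum)

lemma mprod_diff_left: "mprod (x - y) z = mprod x z - mprod y z"
  using mprod_add_left[of "x - y" y z] by (simp add: algebra_simps)

lemma mprod_diff_right: "mprod z (x - y) = mprod z x - mprod z y"
  using mprod_add_right[of z "x - y" y] by (simp add: algebra_simps)

lemma jordan_prod_add_left: "jordan_prod (x + y) z = jordan_prod x z + jordan_prod y z"
  by (simp add: jordan_prod_def mprod_add_left mprod_add_right scaleR_add_right)

lemma jordan_prod_add_right: "jordan_prod z (x + y) = jordan_prod z x + jordan_prod z y"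
  by (simp add: jordan_prod_def mprod_add_left mprod_add_right scaleR_add_right)

lemma mtrace_add: "mtrace (x + y) = mtrace x + mtrace y"
  by (simp add: mtrace_def sum.distrib)

lemma mtrace_scaleR: "mtrace (r *\<^sub>R x) = r *\<^sub>R mtrace x"
  by (simp add: mtrace_def scaleR_right.sum)

lemma Herm_iff: "x \<in> Herm \<longleftrightarrow> (\<forall>i j. hconj (x $ i $ j) = x $ j $ i)"
  by (auto simp: Herm_def vec_eq_iff transpose_def mconj_def)

lemma Herm_hconj: "x \<in> Herm \<Longrightarrow> hconj (x $ i $ j) = x $ j $ i"
  by (simp add: Herm_iff)

lemma Herm_diagonal: "x \<in> Herm \<Longrightarrow> x $ i $ i = hre (x $ i $ i) *\<^sub>R 1"
  by (intro hconj_fixed_eq Herm_hconj)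

lemma Herm_jordan_prod: "x \<in> Herm \<Longrightarrow> y \<in> Herm \<Longrightarrow> jordan_prod x y \<in> Herm"
  by (simp add: Herm_iff jordan_prod_def mprod_def hconj_add hconj_scaleR hconj_sum hconj_mult
      add.commute)

lemma hre_mult_Herm: "y \<in> Herm \<Longrightarrow> hre (a * y $ l $ i) = hinner a (y $ i $ l)"
  by (simp add: hinner_def Herm_hconj)

lemma mtrace_Herm: "x \<in> Herm \<Longrightarrow> mtrace x = hre (mtrace x) *\<^sub>R 1"
  by (rule hconj_fixed_eq) (simp add: mtrace_def hconj_sum Herm_hconj)

definition minner :: "'k::conj_algebra^'n^'n \<Rightarrow> 'k^'n^'n \<Rightarrow> real" where
  "minner x y = (\<Sum>i\<in>UNIV. \<Sum>j\<in>UNIV. hinner (x $ i $ j) (y $ i $ j))"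

lemma minner_commute: "minner x y = minner y x"
  by (simp add: minner_def hinner_commute)

lemma minner_add_left: "minner (x + y) z = minner x z + minner y z"
  by (simp add: minner_def hinner_add_left sum.distrib)

lemma minner_scaleR_left: "minner (r *\<^sub>R x) z = r * minner x z"
  by (simp add: minner_def hinner_scaleR_left sum_distrib_left)

lemma minner_add_right: "minner z (x + y) = minner z x + minner z y"
  by (simp add: minner_commute[of z] minner_add_left)

lemma minner_scaleR_right: "minner z (r *\<^sub>R x) = r * minner z x"
  by (simp add: minner_commute[of z] minner_scaleR_left)

lemma minner_diff_left: "minner (x - y) z = minner x z - minner y z"
  using minner_add_left[of "x - y" y z] by simp

lemma minner_diff_right: "minner z (x - y) = minner z x - minner z y"
  using minner_add_right[of z "x - y" y] by simp

lemma minner_zero_right: "minner x 0 = 0"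
  using minner_scaleR_right[of x 0 0] by simp

lemmas minner_bilinear = minner_add_left minner_add_right minner_diff_left minner_diff_right
  minner_scaleR_left minner_scaleR_right

lemma hre_mtrace_mprod:
  assumes "y \<in> Herm"
  shows "hre (mtrace (mprod x y)) = minner x y"
  by (simp add: mtrace_def mprod_def minner_def hre_sum hre_mult_Herm[OF assms])

lemma hre_mtrace_jordan_prod:
  assumes "x \<in> Herm" "y \<in> Herm"
  shows "hre (mtrace (jordan_prod x y)) = minner x y"
  using assms by (simp add: jordan_prod_def mtrace_scaleR mtrace_add hre_scaleR hre_add
      hre_mtrace_mprod minner_commute)

text \<open>The trace is the pairing with the identity, which makes the trace corrections in the
deunitalized product accessible to bilinear algebra.\<close>

lemma hre_mtrace_eq_minner: "hre (mtrace x) = minner x (mat 1)"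
proof -
  have "(\<Sum>j\<in>UNIV. hinner (x $ i $ j) (mat 1 $ i $ j)) = hre (x $ i $ i)" for i
  proof -
    have "(\<Sum>j\<in>UNIV. hinner (x $ i $ j) (mat 1 $ i $ j)) 
        = (\<Sum>j\<in>UNIV. if j = i then hre (x $ i $ i) else 0)"
      by (rule sum.cong) (auto simp: mat_def hinner_def hconj_one hmult_one_right hconj_zero
          hmult_zero_right hre_zero)
    then show ?thesis by simp
  qed
  then show ?thesis by (simp add: mtrace_def minner_def hre_sum)
qed

lemma minner_mat_1_self: "minner (mat 1) (mat 1 :: 'k::conj_algebra^'n^'n) = real CARD('n)"
  unfolding hre_mtrace_eq_minner[symmetric] 
  by (simp add: mtrace_def mat_def hre_sum hre_one)

lemma herm_metric_eq:
  assumes "x \<in> Herm" "y \<in> Herm"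
  shows "herm_metric x (y :: 'k::conj_algebra^'n^'n) = minner x y / real CARD('n)"
  by (simp add: herm_metric_def hre_mtrace_jordan_prod[OF assms])

lemma herm_circ_eq:
  assumes "x \<in> Herm" "y \<in> Herm"
  shows "herm_circ x (y :: 'k::conj_algebra^'n^'n)
       = jordan_prod x y - herm_metric x y *\<^sub>R mat 1"
proof -
  have "mtrace (jordan_prod x y) = minner x y *\<^sub>R (1::'k)"
    using mtrace_Herm[OF Herm_jordan_prod[OF assms]] hre_mtrace_jordan_prod[OF assms] by simp
  then show ?thesis
    by (simp add: herm_circ_def herm_metric_eq[OF assms] vec_eq_iff mat_def)
qed

lemma Herm_diff_scaleR: "x \<in> Herm \<Longrightarrow> y \<in> Herm \<Longrightarrow> x - r *\<^sub>R y \<in> Herm"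
  by (simp add: Herm_iff hconj_diff hconj_scaleR)

lemma Herm_mat_1: "mat 1 \<in> Herm"
  by (auto simp: Herm_iff mat_def hconj_one hconj_zero)

lemma Herm_herm_circ:
  assumes "x \<in> Herm" "y \<in> Herm" shows "herm_circ x y \<in> Herm"
  by (simp add: herm_circ_eq assms Herm_diff_scaleR Herm_jordan_prod Herm_mat_1)

text \<open>For associative scalars and Hermitian matrices this is a quarter of the squared norm of the
commutator.\<close>

definition jordan_defect :: "'k::conj_algebra^'n^'n \<Rightarrow> 'k^'n^'n \<Rightarrow> real" where
  "jordan_defect x y = minner (jordan_prod x x) (jordan_prod y y)
     - minner (jordan_prod x y) (jordan_prod x y)"

definition gram_det :: "'k::conj_algebra^'n^'n \<Rightarrow> 'k^'n^'n \<Rightarrow> real" where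
  "gram_det x y = minner x x * minner y y - (minner x y)\<^sup>2"

text \<open>With \<open>\<langle>I, I\<rangle> = n\<close> and \<open>\<langle>x \<star> y, I\<rangle> = \<langle>x, y\<rangle>\<close> the three correction terms collapse to one.\<close>

lemma minner_herm_circ:
  fixes x y z w :: "'k::conj_algebra^'n^'n"
  assumes "x \<in> Herm" "y \<in> Herm" "z \<in> Herm" "w \<in> Herm"
  shows "minner (herm_circ x y) (herm_circ z w)
       = minner (jordan_prod x y) (jordan_prod z w) - minner x y * minner z w / real CARD('n)"
proof -
  have "minner (jordan_prod x y) (mat 1) = minner x y" "minner (mat 1) (jordan_prod z w) = minner z w"
    using assms by (simp_all add: hre_mtrace_eq_minner[symmetric] hre_mtrace_jordan_prod
        minner_commute[of "mat 1"])
  then show ?thesis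
    using assms
    by (simp add: herm_circ_eq minner_bilinear minner_mat_1_self herm_metric_eq field_simps)
qed

text \<open>The correction terms of \<open>minner_herm_circ\<close> add up to minus the denominator, up to the
normalisation of the metric; this is the source of the lower bound \<open>-1\<close>.\<close>

lemma herm_sect_eq:
  fixes x y :: "'k::conj_algebra^'n^'n"
  assumes x: "x \<in> Herm" and y: "y \<in> Herm" and nz: "gram_det x y \<noteq> 0"
  shows "herm_sect x y = real CARD('n) * jordan_defect x y / gram_det x y - 1"
proof -
  note [simp] = x y Herm_herm_circ herm_metric_eq minner_herm_circ
  have "herm_metric (herm_circ x x) (herm_circ y y) - herm_metric (herm_circ x y) (herm_circ x y)
      = (jordan_defect x y - gram_det x y / real CARD('n)) / real CARD('n)"
    by (simp add: jordan_defect_def gram_det_def power2_eq_square diff_divide_distrib)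
  moreover have "herm_metric x x * herm_metric y y - (herm_metric x y)\<^sup>2
      = gram_det x y / (real CARD('n))\<^sup>2"
    by (simp add: gram_det_def power2_eq_square diff_divide_distrib)
  ultimately have "herm_sect x y = ((jordan_defect x y - gram_det x y / real CARD('n)) / real CARD('n))
      / (gram_det x y / (real CARD('n))\<^sup>2)"
    unfolding herm_sect_def sect_nonassoc_def by simp
  also have "\<dots> = real CARD('n) * jordan_defect x y / gram_det x y - 1"
    using nz by (simp add: field_simps power2_eq_square)
  finally show ?thesis .
qed

section \<open>The associator over associative scalars\<close>

text \<open>The multiples of the identity that arise in the two bracketings cancel, since the trace form is
invariant; the corrections to the inner factors leave multiples of \<open>z\<close> and \<open>x\<close>. What remains is
the Jordan associator, in which the surviving triple products form a double commutator.\<close>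

lemma associative_associator_eq:
  fixes x y z :: "'k::conj_algebra^'n^'n"
  assumes assoc: "\<And>a b c :: 'k. (a * b) * c = a * (b * c)"
    and x: "x \<in> Herm0" and y: "y \<in> Herm0" and z: "z \<in> Herm0"
  shows "associator herm_circ x y z = (1/4) *\<^sub>R mcommutator y (mcommutator x z)
           - herm_metric x y *\<^sub>R z + herm_metric y z *\<^sub>R x"
proof -
  have massoc: "mprod (mprod a b) c = mprod a (mprod b c)" for a b c :: "'k^'n^'n"
    unfolding mprod_def
    by (simp add: vec_eq_iff hmult_sum_left hmult_sum_right assoc) (intro allI sum.swap)
  have H: "x \<in> Herm" "y \<in> Herm" "z \<in> Herm" using x y z by (auto simp: Herm0_def)
  have tr0: "minner x (mat 1) = 0" "minner z (mat 1) = 0"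
    using x z by (simp_all add: hre_mtrace_eq_minner[symmetric] Herm0_def hre_zero)
  have one: "mprod (mat 1) a = a" "mprod a (mat 1) = a" for a :: "'k^'n^'n"
    by (simp_all add: mprod_def vec_eq_iff mat_def if_distribR if_distrib[where f = "(*) _"]
        if_distrib[where f = "(*)"] hmult_one_left hmult_one_right hmult_zero_left hmult_zero_right
        cong: if_cong)
  have trace_assoc: "minner (jordan_prod x y) z = minner x (jordan_prod y z)"
  proof -
    have cyc: "hre (mtrace (mprod a b)) = hre (mtrace (mprod b a))" for a b :: "'k^'n^'n"
      unfolding mtrace_def mprod_def
      by (simp add: hre_sum hre_mult_commute) (rule sum.swap)
    show ?thesis
      using H cyc[of y "mprod x z"]
      unfolding hre_mtrace_mprod[OF H(3), symmetric] minner_commute[of x]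
        hre_mtrace_mprod[OF H(1), symmetric]
      using cyc[of "mprod y z" x]  cyc[of "mprod z y" x]
      by (simp add: jordan_prod_def mprod_add_left mprod_scaleR_left mtrace_add mtrace_scaleR
          hre_add hre_scaleR massoc)
  qed
  have metric_circ: "herm_metric (herm_circ x y) z = minner (jordan_prod x y) z / real CARD('n)"
    "herm_metric x (herm_circ y z) = minner x (jordan_prod y z) / real CARD('n)"
    using H tr0 by (simp_all add: herm_metric_eq Herm_herm_circ)
      (simp_all add: herm_circ_eq minner_bilinear minner_commute[of "mat 1"])
  have "associator herm_circ x y z = jordan_prod (jordan_prod x y) z - jordan_prod x (jordan_prod y z)
      - herm_metric x y *\<^sub>R z + herm_metric y z *\<^sub>R x"
    using H
    by (simp add: associator_def herm_circ_eq[OF Herm_herm_circ] herm_circ_eq[OF _ Herm_herm_circ] 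
        metric_circ trace_assoc)
      (simp add: herm_circ_eq jordan_prod_def mprod_diff_left mprod_diff_right mprod_scaleR_left
        mprod_scaleR_right one algebra_simps flip: scaleR_add_left)
  also have "jordan_prod (jordan_prod x y) z - jordan_prod x (jordan_prod y z)
      = (1/4) *\<^sub>R mcommutator y (mcommutator x z)"
    by (simp add: jordan_prod_def mcommutator_def mprod_diff_left mprod_diff_right
        mprod_add_left mprod_add_right mprod_scaleR_left mprod_scaleR_right massoc algebra_simps)
  finally show ?thesis .
qed

section \<open>Norm estimates\<close>

context alternative_conj_algebra
begin

lemma minner_self_nonneg: "minner x (x :: 'k^'n^'n) \<ge> 0"
  unfolding minner_def by (intro sum_nonneg hinner_self_nonneg)

lemma minner_self_eq_0: "minner x (x :: 'k^'n^'n) = 0 \<Longrightarrow> x = 0"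
  unfolding minner_def
  by (simp add: sum_nonneg_eq_0_iff sum_nonneg hinner_self_nonneg vec_eq_iff)
     (metis hinner_self_pos less_irrefl)

lemma gram_det_identity:
  "minner (minner y y *\<^sub>R x - minner x y *\<^sub>R y) (minner y y *\<^sub>R x - minner x y *\<^sub>R y)
     = minner y y * gram_det x (y :: 'k^'n^'n)"
  by (simp add: minner_bilinear gram_det_def power2_eq_square minner_commute[of y x] algebra_simps)

lemma gram_det_nonneg: "gram_det x (y :: 'k^'n^'n) \<ge> 0"
proof (cases "y = 0")
  case False
  then have "minner y y > 0" using minner_self_nonneg[of y] minner_self_eq_0[of y] by fastforce
  then show ?thesis using gram_det_identity[of y x] 
    minner_self_nonneg[of "minner y y *\<^sub>R x - minner x y *\<^sub>R y"]
    by (simp add: zero_le_mult_iff)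
qed (simp add: gram_det_def minner_zero_right)

lemma lin_indep_pair_iff_gram_det: "lin_indep_pair x (y :: 'k^'n^'n) \<longleftrightarrow> gram_det x y > 0"
proof
  assume ind: "lin_indep_pair x y"
  then have y: "y \<noteq> 0" using dependent_zero[of "{x, y}"] by (auto simp: lin_indep_pair_def)
  then have pos: "minner y y > 0" using minner_self_nonneg[of y] minner_self_eq_0[of y] by fastforce
  show "gram_det x y > 0"
  proof (rule ccontr)
    assume "\<not> ?thesis"
    then have "gram_det x y = 0" using gram_det_nonneg[of x y] by simp
    then have "minner y y *\<^sub>R x = minner x y *\<^sub>R y"
      using gram_det_identity[of y x] minner_self_eq_0 by fastforce
    then have "inverse (minner y y) *\<^sub>R (minner y y *\<^sub>R x) = inverse (minner y y) *\<^sub>R (minner x y *\<^sub>R y)"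
      by simp
    then have "x = (inverse (minner y y) * minner x y) *\<^sub>R y"
      using pos by simp
    then have "x \<in> span {y}" by (metis span_base span_scale singletonI)
    then show False using ind
      by (simp add: lin_indep_pair_def independent_insert)
  qed
next
  assume pos: "gram_det x y > 0"
  then have "y \<noteq> 0" "x \<noteq> y" by (auto simp: gram_det_def minner_zero_right power2_eq_square)
  moreover have "x \<notin> span {y}"
  proof
    assume "x \<in> span {y}"
    then obtain c where "x = c *\<^sub>R y" by (auto simp: span_singleton)
    then show False using pos by (simp add: gram_det_def minner_bilinear power2_eq_square)
  qed
  ultimately show "lin_indep_pair x y"
    by (simp add: lin_indep_pair_def independent_insert)
qed

text \<open>The norm of the scalars is multiplicative, so the usual estimate of a product of matrices
applies; the crude factor suffices for a continuity argument.\<close>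

lemma minner_mprod_le:
  fixes x y :: "'k^'n^'n"
  shows "minner (mprod x y) (mprod x y) \<le> real CARD('n) * (minner x x * minner y y)"
proof -
  let ?N = "\<lambda>a::'k. hinner a a"
  have col: "(\<Sum>j\<in>UNIV. ?N (y $ l $ j)) \<le> minner y y" for l
    unfolding minner_def 
    by (rule member_le_sum[where f = "\<lambda>l. \<Sum>j\<in>UNIV. ?N (y $ l $ j)"]) (auto intro: sum_nonneg hinner_self_nonneg)
  have "minner (mprod x y) (mprod x y)
      \<le> (\<Sum>i\<in>UNIV. \<Sum>j\<in>UNIV. real CARD('n) * (\<Sum>l\<in>UNIV. ?N (x $ i $ l * y $ l $ j)))"
    unfolding minner_def mprod_def by (auto intro!: sum_mono hinner_sum_self_le)
  also have "\<dots> = real CARD('n) * (\<Sum>i\<in>UNIV. \<Sum>l\<in>UNIV. ?N (x $ i $ l) * (\<Sum>j\<in>UNIV. ?N (y $ l $ j)))"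
    by (simp add: hinner_mult_self sum_distrib_left) (auto intro!: sum.cong sum.swap)
  also have "\<dots> \<le> real CARD('n) * (\<Sum>i\<in>UNIV. \<Sum>l\<in>UNIV. ?N (x $ i $ l) * minner y y)"
    by (intro mult_left_mono sum_mono col hinner_self_nonneg) simp_all
  also have "\<dots> = real CARD('n) * (minner x x * minner y y)"
    by (simp add: minner_def sum_distrib_right)
  finally show ?thesis .
qed

lemma minner_jordan_prod_le:
  fixes x y :: "'k^'n^'n"
  shows "minner (jordan_prod x y) (jordan_prod x y) \<le> real CARD('n) * (minner x x * minner y y)"
proof -
  let ?p = "mprod x y" and ?q = "mprod y x"
  have "4 * minner (jordan_prod x y) (jordan_prod x y) = minner (?p + ?q) (?p + ?q)"
    by (simp add: jordan_prod_def minner_scaleR_left minner_scaleR_right)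
  also have "\<dots> = 2 * minner ?p ?p + 2 * minner ?q ?q - minner (?p - ?q) (?p - ?q)"
    by (simp add: minner_bilinear)
  also have "\<dots> \<le> 2 * minner ?p ?p + 2 * minner ?q ?q"
    using minner_self_nonneg[of "?p - ?q"] by simp
  also have "\<dots> \<le> 4 * (real CARD('n) * (minner x x * minner y y))"
    using minner_mprod_le[of x y] minner_mprod_le[of y x] by (simp add: mult.commute)
  finally show ?thesis by simp
qed

end

section \<open>The diagonal case\<close>

definition diag_part :: "'k::conj_algebra^'n^'n \<Rightarrow> 'k^'n^'n" where
  "diag_part x = (\<chi> i j. if i = j then x $ i $ i else 0)"

definition offdiag_part :: "'k::conj_algebra^'n^'n \<Rightarrow> 'k^'n^'n" where
  "offdiag_part x = (\<chi> i j. if i = j then 0 else x $ i $ j)"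

lemma diag_plus_offdiag: "diag_part x + offdiag_part x = x"
  by (simp add: diag_part_def offdiag_part_def vec_eq_iff)

lemma minner_diag_part: "minner (diag_part x) (diag_part x) = (\<Sum>i\<in>UNIV. hinner (x $ i $ i) (x $ i $ i))"
proof -
  have "(\<Sum>j\<in>UNIV. hinner (diag_part x $ i $ j) (diag_part x $ i $ j)) = hinner (x $ i $ i) (x $ i $ i)" for i
    by (simp add: diag_part_def if_distrib[of "\<lambda>t. hinner t t"] hinner_zero_left cong: if_cong)
  then show ?thesis by (simp add: minner_def)
qed

lemma minner_diag_offdiag: "minner (diag_part x) (offdiag_part x) = 0"
  unfolding minner_def diag_part_def offdiag_part_def
  by (intro sum.neutral ballI) (auto simp: hinner_zero_left hinner_zero_right)

lemma minner_self_split: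
  "minner x x = minner (diag_part x) (diag_part x) + minner (offdiag_part x) (offdiag_part x)"
proof -
  let ?d = "diag_part x" and ?o = "offdiag_part x"
  have "minner (?d + ?o) (?d + ?o) = minner ?d ?d + minner ?o ?o"
    using minner_diag_offdiag[of x] minner_commute[of ?d ?o]
    by (simp add: minner_add_left minner_add_right)
  then show ?thesis by (simp only: diag_plus_offdiag)
qed

lemma minner_offdiag_part:
  "minner (offdiag_part x) (offdiag_part x)
     = minner x x - (\<Sum>i\<in>UNIV. hinner (x $ i $ i) (x $ i $ i))"
  using minner_self_split[of x] minner_diag_part[of x] by simp

text \<open>Multiplication by a real diagonal matrix scales the entry \<open>(i, j)\<close> by \<open>(e\<^sub>i + e\<^sub>j)/2\<close>, and its
square scales it by \<open>(e\<^sub>i\<^sup>2 + e\<^sub>j\<^sup>2)/2\<close>; the weight is \<open>(e\<^sub>i\<^sup>2 + e\<^sub>j\<^sup>2)/2 - (e\<^sub>i + e\<^sub>j)\<^sup>2/4\<close>.\<close>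

lemma jordan_defect_diagonal:
  fixes d y :: "'k::conj_algebra^'n^'n" and e :: "'n \<Rightarrow> real"
  assumes d: "\<And>i j. d $ i $ j = (if i = j then e i *\<^sub>R 1 else 0)" and y: "y \<in> Herm"
  shows "jordan_defect d y = (\<Sum>i\<in>UNIV. \<Sum>j\<in>UNIV. (e i - e j)\<^sup>2 / 4 * hinner (y $ i $ j) (y $ i $ j))"
proof -
  let ?N = "\<lambda>i j. hinner (y $ i $ j) (y $ i $ j)"
  have dl: "mprod d z $ i $ j = e i *\<^sub>R z $ i $ j" and dr: "mprod z d $ i $ j = e j *\<^sub>R z $ i $ j"
    for z i j
    by (simp_all add: mprod_def d if_distribR if_distrib[where f = "(*) _"]
        if_distrib[where f = "(*)"] hmult_one_left hmult_one_right hmult_zero_left hmult_zero_right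
        hmult_scaleR_left hmult_scaleR_right cong: if_cong)
  have jd: "jordan_prod d z $ i $ j = ((e i + e j) / 2) *\<^sub>R z $ i $ j" for z i j
    by (simp add: jordan_prod_def dl dr add_divide_distrib scaleR_add_left scaleR_add_right)
  have dd: "hinner (jordan_prod d d $ i $ j) b = (if i = j then (e i)\<^sup>2 * hre b else 0)" for i j b
    by (simp add: jd d hinner_scaleR_left hinner_zero_left power2_eq_square)
      (simp add: hinner_def hmult_one_left hre_hconj)
  have yy: "hre (jordan_prod y y $ i $ i) = (\<Sum>j\<in>UNIV. ?N i j)" for i
    by (simp add: jordan_prod_def mprod_def hre_scaleR hre_add hre_sum hre_mult_Herm[OF y])
  \<comment> \<open>Symmetry of the norms of the entries allows averaging the weight over \<open>(i, j)\<close> and \<open>(j, i)\<close>.\<close>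
  have sym: "?N i j = ?N j i" for i j
    using hinner_hconj[of "y $ i $ j" "y $ i $ j"] Herm_hconj[OF y, of i j] by simp
  have "minner (jordan_prod d d) (jordan_prod y y) = (\<Sum>i\<in>UNIV. \<Sum>j\<in>UNIV. (e i)\<^sup>2 * ?N i j)"
    by (simp add: minner_def dd yy sum_distrib_left)
  moreover have "(\<Sum>i\<in>UNIV. \<Sum>j\<in>UNIV. (e i)\<^sup>2 * ?N i j) = (\<Sum>i\<in>UNIV. \<Sum>j\<in>UNIV. (e j)\<^sup>2 * ?N i j)"
    by (subst sum.swap) (simp add: sym)
  ultimately have "minner (jordan_prod d d) (jordan_prod y y)
      = (\<Sum>i\<in>UNIV. \<Sum>j\<in>UNIV. (e i)\<^sup>2 / 2 * ?N i j) + (\<Sum>i\<in>UNIV. \<Sum>j\<in>UNIV. (e j)\<^sup>2 / 2 * ?N i j)"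
    by (simp flip: sum_divide_distrib)
  moreover have "minner (jordan_prod d y) (jordan_prod d y)
      = (\<Sum>i\<in>UNIV. \<Sum>j\<in>UNIV. ((e i + e j) / 2)\<^sup>2 * ?N i j)"
    by (simp add: minner_def jd hinner_scaleR_left hinner_scaleR_right power2_eq_square mult.assoc)
  ultimately show ?thesis
    unfolding jordan_defect_def
    by (simp flip: sum.distrib sum_subtractf)
      (intro sum.cong refl, simp add: power2_eq_square field_simps)
qed

section \<open>Symmetries\<close>

text \<open>The trace form is the trace of the Jordan product, so such maps are isometries, and they
preserve everything that can be written with the Jordan product and the trace form.\<close>

definition jordan_isometry :: "('k::conj_algebra^'n^'n \<Rightarrow> 'k^'n^'n) \<Rightarrow> bool" where
  "jordan_isometry T \<longleftrightarrow> (\<forall>x\<in>Herm. T x \<in> Herm \<and> mtrace (T x) = mtrace x) \<and>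
     (\<forall>x\<in>Herm. \<forall>y\<in>Herm. T (jordan_prod x y) = jordan_prod (T x) (T y))"

lemma jordan_isometry_id: "jordan_isometry (\<lambda>x. x)"
  by (simp add: jordan_isometry_def)

lemma jordan_isometry_comp: "jordan_isometry S \<Longrightarrow> jordan_isometry T \<Longrightarrow> jordan_isometry (\<lambda>x. S (T x))"
  by (simp add: jordan_isometry_def)

lemma jordan_isometry_Herm: "jordan_isometry T \<Longrightarrow> x \<in> Herm \<Longrightarrow> T x \<in> Herm"
  by (simp add: jordan_isometry_def)

lemma minner_jordan_isometry:
  assumes "jordan_isometry T" "x \<in> Herm" "y \<in> Herm"
  shows "minner (T x) (T y) = minner x y"
  using assms unfolding jordan_isometry_def
  by (metis hre_mtrace_jordan_prod Herm_jordan_prod)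

lemma gram_det_jordan_isometry:
  assumes "jordan_isometry T" "x \<in> Herm" "y \<in> Herm"
  shows "gram_det (T x) (T y) = gram_det x y"
  using assms by (simp add: gram_det_def minner_jordan_isometry)

lemma jordan_defect_jordan_isometry:
  assumes T: "jordan_isometry T" and "x \<in> Herm" "y \<in> Herm"
  shows "jordan_defect (T x) (T y) = jordan_defect x y"
proof -
  have "jordan_prod (T a) (T b) = T (jordan_prod a b)" if "a \<in> Herm" "b \<in> Herm" for a b
    using T that by (simp add: jordan_isometry_def)
  then show ?thesis using assms
    by (simp add: jordan_defect_def minner_jordan_isometry Herm_jordan_prod)
qed

text \<open>For a real matrix \<open>r\<close> the map \<open>x \<mapsto> r x r\<^sup>T\<close> is split into its two one-sided factors, each of
which commutes with multiplication on the other side even when the scalars do not associate.\<close>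

definition row_act :: "('n \<Rightarrow> 'n \<Rightarrow> real) \<Rightarrow> 'k::conj_algebra^'n^'n \<Rightarrow> 'k^'n^'n" where
  "row_act r x = (\<chi> i j. \<Sum>a\<in>UNIV. r i a *\<^sub>R x $ a $ j)"

definition col_act :: "('n \<Rightarrow> 'n \<Rightarrow> real) \<Rightarrow> 'k::conj_algebra^'n^'n \<Rightarrow> 'k^'n^'n" where
  "col_act r x = (\<chi> i j. \<Sum>b\<in>UNIV. r j b *\<^sub>R x $ i $ b)"

lemma row_act_col_act: "row_act r (col_act r x) = col_act r (row_act r x)"
  by (simp add: row_act_def col_act_def vec_eq_iff scaleR_right.sum mult.commute)
     (intro allI sum.swap)

lemma mprod_row_act: "mprod (row_act r x) y = row_act r (mprod x y)"
  by (simp add: row_act_def mprod_def vec_eq_iff scaleR_right.sum hmult_sum_left hmult_scaleR_left)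
     (intro allI sum.swap)

lemma mprod_col_act: "mprod x (col_act r y) = col_act r (mprod x y)"
  by (simp add: col_act_def mprod_def vec_eq_iff scaleR_right.sum hmult_sum_right hmult_scaleR_right)
     (intro allI sum.swap)

lemma mprod_col_row_act:
  assumes orth: "\<And>a b. (\<Sum>l\<in>UNIV. r l a * r l b) = (if a = b then 1 else 0)"
  shows "mprod (col_act r x) (row_act r y) = mprod x y"
proof -
  have "(\<Sum>l\<in>UNIV. (\<Sum>a\<in>UNIV. r l a *\<^sub>R f a) * (\<Sum>b\<in>UNIV. r l b *\<^sub>R g b)) = (\<Sum>a\<in>UNIV. f a * g a)"
    for f g :: "'a \<Rightarrow> 'b"
  proof -
    have "(\<Sum>l\<in>UNIV. (\<Sum>a\<in>UNIV. r l a *\<^sub>R f a) * (\<Sum>b\<in>UNIV. r l b *\<^sub>R g b))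
        = (\<Sum>l\<in>UNIV. \<Sum>a\<in>UNIV. \<Sum>b\<in>UNIV. (r l a * r l b) *\<^sub>R (f a * g b))"
      unfolding hmult_sum_left unfolding hmult_sum_right
      by (simp add: hmult_scaleR_left hmult_scaleR_right mult.commute)
    also have "\<dots> = (\<Sum>a\<in>UNIV. \<Sum>l\<in>UNIV. \<Sum>b\<in>UNIV. (r l a * r l b) *\<^sub>R (f a * g b))"
      by (rule sum.swap)
    also have "\<dots> = (\<Sum>a\<in>UNIV. \<Sum>b\<in>UNIV. \<Sum>l\<in>UNIV. (r l a * r l b) *\<^sub>R (f a * g b))"
      by (intro sum.cong refl sum.swap)
    also have "\<dots> = (\<Sum>a\<in>UNIV. \<Sum>b\<in>UNIV. (\<Sum>l\<in>UNIV. r l a * r l b) *\<^sub>R (f a * g b))"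
      by (simp only: scaleR_left.sum)
    also have "\<dots> = (\<Sum>a\<in>UNIV. \<Sum>b\<in>UNIV. if a = b then f a * g b else 0)"
      by (simp only: orth) (intro sum.cong refl, simp)
    finally show ?thesis by simp
  qed
  then show ?thesis by (simp add: mprod_def col_act_def row_act_def vec_eq_iff)
qed

lemma jordan_isometry_orthogonal:
  assumes orth: "\<And>a b. (\<Sum>l\<in>UNIV. r l a * r l b) = (if a = b then 1 else 0)"
  shows "jordan_isometry (\<lambda>x. row_act r (col_act r x))"
proof -
  let ?T = "\<lambda>x. row_act r (col_act r x)"
  have prod: "mprod (?T x) (?T y) = ?T (mprod x y)" for x y
  proof -
    have "mprod (?T x) (?T y) = mprod (row_act r (col_act r x)) (col_act r (row_act r y))"
      by (simp only: row_act_col_act)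
    also have "\<dots> = ?T (mprod (col_act r x) (row_act r y))"
      by (simp only: mprod_row_act mprod_col_act) (simp only: row_act_col_act)
    finally show ?thesis by (simp only: mprod_col_row_act[OF orth])
  qed
  have lin: "?T (c *\<^sub>R (x + y)) = c *\<^sub>R (?T x + ?T y)" for c x y
    by (simp add: row_act_def col_act_def vec_eq_iff scaleR_right.sum scaleR_add_right sum.distrib
        mult_ac)
  have herm: "?T x \<in> Herm" if "x \<in> Herm" for x
    unfolding Herm_iff
    by (simp add: row_act_def col_act_def hconj_sum hconj_scaleR Herm_hconj[OF that]
        scaleR_right.sum mult.commute) (intro allI sum.swap)
  have tr: "mtrace (?T x) = mtrace x" for x
  proof -
    have "mtrace (?T x) = (\<Sum>i\<in>UNIV. \<Sum>a\<in>UNIV. \<Sum>b\<in>UNIV. (r i a * r i b) *\<^sub>R x $ a $ b)"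
      by (simp add: mtrace_def row_act_def col_act_def scaleR_right.sum)
    also have "\<dots> = (\<Sum>a\<in>UNIV. \<Sum>i\<in>UNIV. \<Sum>b\<in>UNIV. (r i a * r i b) *\<^sub>R x $ a $ b)"
      by (rule sum.swap)
    also have "\<dots> = (\<Sum>a\<in>UNIV. \<Sum>b\<in>UNIV. \<Sum>i\<in>UNIV. (r i a * r i b) *\<^sub>R x $ a $ b)"
      by (intro sum.cong refl sum.swap)
    also have "\<dots> = (\<Sum>a\<in>UNIV. \<Sum>b\<in>UNIV. (\<Sum>i\<in>UNIV. r i a * r i b) *\<^sub>R x $ a $ b)"
      by (simp only: scaleR_left.sum)
    also have "\<dots> = (\<Sum>a\<in>UNIV. \<Sum>b\<in>UNIV. if a = b then x $ a $ b else 0)"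
      by (simp only: orth) (intro sum.cong refl, simp)
    finally show ?thesis by (simp add: mtrace_def)
  qed
  show ?thesis
    unfolding jordan_isometry_def by (simp add: herm tr jordan_prod_def lin prod)
qed

definition plane_rotation :: "'n \<Rightarrow> 'n \<Rightarrow> real \<Rightarrow> real \<Rightarrow> 'n \<Rightarrow> 'n \<Rightarrow> real" where
  "plane_rotation p q c s i a =
     (if i = p then (if a = p then c else 0) + (if a = q then s else 0)
      else if i = q then (if a = p then - s else 0) + (if a = q then c else 0)
      else if a = i then 1 else 0)"

lemma sum_plane_rotation:
  fixes v :: "'n::finite \<Rightarrow> 'v::real_vector"
  shows "(\<Sum>a\<in>UNIV. plane_rotation p q c s i a *\<^sub>R v a) =
     (if i = p then c *\<^sub>R v p + s *\<^sub>R v q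
      else if i = q then - s *\<^sub>R v p + c *\<^sub>R v q else v i)"
  by (simp add: plane_rotation_def scaleR_add_left sum.distrib if_distrib[of "\<lambda>t. t *\<^sub>R _"]
      if_distribR if_distrib[where f = scaleR] cong: if_cong)

lemma plane_rotation_orthogonal:
  fixes p q a b :: "'n::finite"
  assumes pq: "p \<noteq> q" and cs: "c\<^sup>2 + s\<^sup>2 = 1"
  shows "(\<Sum>l\<in>UNIV. plane_rotation p q c s l a * plane_rotation p q c s l b) = (if a = b then 1 else 0)"
proof -
  \<comment> \<open>The transpose of a rotation is the rotation by the opposite angle, so the column sums become
    instances of the row formula.\<close>
  have transpose: "plane_rotation p q c s l a = plane_rotation p q c (- s) a l" for l
    using pq by (auto simp: plane_rotation_def)
  show ?thesis
    unfolding transpose[of _]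
    using sum_plane_rotation[of p q c "- s" a "\<lambda>l. plane_rotation p q c s l b"] pq cs
    by (auto simp: plane_rotation_def transpose power2_eq_square)
qed

text \<open>The vectors \<open>(b, t)\<close> and \<open>(cos 2\<theta>, sin 2\<theta>)\<close> have to be orthogonal, so twice the angle is the
argument of \<open>b + i t\<close> minus a right angle.\<close>

lemma annihilating_angle:
  fixes b t :: real
  obtains c s :: real where "c\<^sup>2 + s\<^sup>2 = 1" "b * (c\<^sup>2 - s\<^sup>2) + t * (2 * s * c) = 0"
proof -
  obtain r \<phi> where z: "Complex b t = rcis r \<phi>" using rcis_Ex by blast
  have b: "b = r * cos \<phi>" and t: "t = r * sin \<phi>"
    using arg_cong[OF z, of Re] arg_cong[OF z, of Im] by simp_all
  define \<theta> where "\<theta> = \<phi> / 2 - pi / 4"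
  have 2: "2 * \<theta> = \<phi> - pi / 2" by (simp add: \<theta>_def)
  show ?thesis
  proof
    show "(cos \<theta>)\<^sup>2 + (sin \<theta>)\<^sup>2 = 1" by simp
    have "b * ((cos \<theta>)\<^sup>2 - (sin \<theta>)\<^sup>2) + t * (2 * sin \<theta> * cos \<theta>) = b * cos (2 * \<theta>) + t * sin (2 * \<theta>)"
      by (simp only: cos_double sin_double)
    also have "\<dots> = 0" unfolding 2 b t by (simp add: cos_diff sin_diff)
    finally show "b * ((cos \<theta>)\<^sup>2 - (sin \<theta>)\<^sup>2) + t * (2 * sin \<theta> * cos \<theta>) = 0" .
  qed
qed

text \<open>A rotation in the plane of the two indices preserves the norm of the real symmetric two by two
block. When it diagonalizes the block, the diagonal gains what the two off-diagonal entries
lose.\<close>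

lemma annihilate_real_entry:
  fixes x :: "'k::conj_algebra^'n^'n"
  assumes x: "x \<in> Herm" and pq: "p \<noteq> q" and b: "x $ p $ q = b *\<^sub>R 1"
  obtains T :: "'k^'n^'n \<Rightarrow> 'k^'n^'n" where "jordan_isometry T"
    "(\<Sum>i\<in>UNIV. hinner (T x $ i $ i) (T x $ i $ i)) = (\<Sum>i\<in>UNIV. hinner (x $ i $ i) (x $ i $ i)) + 2 * b\<^sup>2"
proof -
  define \<alpha> \<beta> where "\<alpha> = hre (x $ p $ p)" and "\<beta> = hre (x $ q $ q)"
  have ent: "x $ p $ p = \<alpha> *\<^sub>R 1" "x $ q $ q = \<beta> *\<^sub>R 1" "x $ q $ p = b *\<^sub>R 1"
    using Herm_diagonal[OF x] Herm_hconj[OF x, of p q]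
    by (simp_all add: \<alpha>_def \<beta>_def b hconj_scaleR hconj_one)
  obtain c s :: real where cs: "c\<^sup>2 + s\<^sup>2 = 1"
    and zero: "b * (c\<^sup>2 - s\<^sup>2) + (\<beta> - \<alpha>) / 2 * (2 * s * c) = 0"
    by (rule annihilating_angle)
  let ?r = "plane_rotation p q c s"
  let ?T = "\<lambda>x. row_act ?r (col_act ?r x)"
  let ?N = "\<lambda>a::'k. hinner a a"
  have T: "?T x $ i $ i = (\<Sum>a\<in>UNIV. ?r i a *\<^sub>R (\<Sum>b\<in>UNIV. ?r i b *\<^sub>R x $ a $ b))" for i
    by (simp add: row_act_def col_act_def)
  have "?T x $ p $ p = (c * (c * \<alpha> + s * b) + s * (c * b + s * \<beta>)) *\<^sub>R 1"
    unfolding T sum_plane_rotation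
    by (simp only: pq pq[symmetric] if_False if_True simp_thms ent b scaleR_scaleR
        scaleR_add_left[symmetric])
  then have Np: "?N (?T x $ p $ p) = (c * (c * \<alpha> + s * b) + s * (c * b + s * \<beta>))\<^sup>2"
    by (simp add: hinner_scaleR_left hinner_scaleR_right hinner_one_one power2_eq_square)
  have "?T x $ q $ q = (- s * (- s * \<alpha> + c * b) + c * (- s * b + c * \<beta>)) *\<^sub>R 1"
    unfolding T sum_plane_rotation
    by (simp only: pq pq[symmetric] if_False if_True simp_thms ent b scaleR_scaleR
        scaleR_add_left[symmetric])
  then have Nq: "?N (?T x $ q $ q) = (- s * (- s * \<alpha> + c * b) + c * (- s * b + c * \<beta>))\<^sup>2"
    by (simp add: hinner_scaleR_left hinner_scaleR_right hinner_one_one power2_eq_square)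
  have rest: "?T x $ i $ i = x $ i $ i" if "i \<noteq> p" "i \<noteq> q" for i
    unfolding T sum_plane_rotation using that by simp
  have split: "(\<Sum>i\<in>UNIV. f i) = f p + f q + (\<Sum>i\<in>UNIV - {p} - {q}. f i)" for f :: "'n \<Rightarrow> real"
    using pq by (simp add: sum.remove[of UNIV p] sum.remove[of "UNIV - {p}" q])
  \<comment> \<open>The subtracted square is twice the square of the new entry at \<open>(p, q)\<close>.\<close>
  have "(c * (c * \<alpha> + s * b) + s * (c * b + s * \<beta>))\<^sup>2
      + (- s * (- s * \<alpha> + c * b) + c * (- s * b + c * \<beta>))\<^sup>2
      = (c\<^sup>2 + s\<^sup>2)\<^sup>2 * (\<alpha>\<^sup>2 + \<beta>\<^sup>2 + 2 * b\<^sup>2) - 2 * (b * (c\<^sup>2 - s\<^sup>2) + (\<beta> - \<alpha>) / 2 * (2 * s * c))\<^sup>2"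
    by (simp add: power2_eq_square field_simps)
  then have "(c * (c * \<alpha> + s * b) + s * (c * b + s * \<beta>))\<^sup>2
      + (- s * (- s * \<alpha> + c * b) + c * (- s * b + c * \<beta>))\<^sup>2 = \<alpha>\<^sup>2 + \<beta>\<^sup>2 + 2 * b\<^sup>2"
    using zero by (simp add: cs)
  moreover have "?N (x $ p $ p) = \<alpha>\<^sup>2" "?N (x $ q $ q) = \<beta>\<^sup>2"
    by (simp_all add: ent hinner_scaleR_left hinner_scaleR_right hinner_one_one power2_eq_square)
  ultimately have "(\<Sum>i\<in>UNIV. ?N (?T x $ i $ i)) = (\<Sum>i\<in>UNIV. ?N (x $ i $ i)) + 2 * b\<^sup>2"
    unfolding split by (simp add: Np Nq rest)
  then show ?thesis
    using that[of ?T] jordan_isometry_orthogonal[of ?r] plane_rotation_orthogonal[OF pq cs] by blast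
qed

context alternative_conj_algebra
begin

definition phase_act :: "('n \<Rightarrow> 'k) \<Rightarrow> 'k^'n^'n \<Rightarrow> 'k^'n^'n" where
  "phase_act U x = (\<chi> i j. (U i * x $ i $ j) * hconj (U j))"

lemma phase_act_diagonal:
  assumes unit: "\<And>i. hinner (U i) (U i) = 1" and x: "x \<in> Herm"
  shows "phase_act U x $ i $ i = x $ i $ i"
  using Herm_diagonal[OF x, of i]
  by (metis (no_types, lifting) phase_act_def vec_lambda_beta hmult_scaleR_left hmult_scaleR_right
      hmult_one_right mult_hconj_self unit scaleR_one)

text \<open>At an off-diagonal position \<open>(i, j)\<close> the product is a sum over \<open>l\<close>. The terms with \<open>l\<close> equal to
\<open>i\<close> or \<open>j\<close> contain a real diagonal entry and raise no question of bracketing, the others are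
covered by \<open>autotopy\<close>. A diagonal entry of the Jordan product is a real number given by inner
products of entries, and these are preserved because the phases have norm one.\<close>

lemma jordan_isometry_phase_act:
  fixes U :: "'n::finite \<Rightarrow> 'k"
  assumes unit: "\<And>i. hinner (U i) (U i) = 1"
    and assoc2: "\<And>i j a. (U i * a) * hconj (U j) = U i * (a * hconj (U j))"
    and autotopy: "\<And>i l j a b. i \<noteq> l \<Longrightarrow> l \<noteq> j \<Longrightarrow> i \<noteq> j \<Longrightarrow>
      ((U i * a) * hconj (U l)) * ((U l * b) * hconj (U j)) = (U i * (a * b)) * hconj (U j)"
  shows "jordan_isometry (phase_act U)"
proof -
  note diag = phase_act_diagonal[OF unit]
  have herm: "phase_act U x \<in> Herm" if "x \<in> Herm" for x
    by (simp add: Herm_iff phase_act_def hconj_mult hconj_hconj Herm_hconj[OF that] assoc2)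
  have off_prod: "phase_act U x $ i $ l * phase_act U y $ l $ j = (U i * (x $ i $ l * y $ l $ j)) * hconj (U j)"
    if x: "x \<in> Herm" and y: "y \<in> Herm" and ij: "i \<noteq> j" for x y i l j
  proof -
    consider "l = i" | "l = j" | "l \<noteq> i" "l \<noteq> j" by blast
    then show ?thesis
    proof cases
      case 1
      show ?thesis unfolding 1 diag[OF x] using Herm_diagonal[OF x, of i]
        by (metis (no_types, lifting) phase_act_def vec_lambda_beta hmult_scaleR_left hmult_scaleR_right
            hmult_one_left)
    next
      case 2
      show ?thesis unfolding 2 diag[OF y] using Herm_diagonal[OF y, of j]
        by (metis (no_types, lifting) phase_act_def vec_lambda_beta hmult_scaleR_left hmult_scaleR_right
            hmult_one_right)
    next
      case 3
      then show ?thesis using ij autotopy[of i l j] by (simp add: phase_act_def)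
    qed
  qed
  have inner: "hinner (phase_act U x $ i $ l) (phase_act U y $ i $ l) = hinner (x $ i $ l) (y $ i $ l)"
    for x y i l
    by (simp add: phase_act_def hinner_mult_left hinner_mult_right hinner_hconj unit)
  have diag_prod: "hre (jordan_prod x y $ i $ i) = (\<Sum>l\<in>UNIV. hinner (x $ i $ l) (y $ i $ l))"
    if x: "x \<in> Herm" and y: "y \<in> Herm" for x y :: "'k^'n^'n" and i
    by (simp add: jordan_prod_def mprod_def hre_scaleR hre_add hre_sum hre_mult_Herm[OF x]
        hre_mult_Herm[OF y] hinner_commute)
  have "phase_act U (jordan_prod x y) $ i $ j = jordan_prod (phase_act U x) (phase_act U y) $ i $ j"
    if x: "x \<in> Herm" and y: "y \<in> Herm" for x y i j
  proof (cases "i = j")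
    case True
    have "hre (jordan_prod (phase_act U x) (phase_act U y) $ i $ i) = hre (jordan_prod x y $ i $ i)"
      by (simp add: diag_prod herm x y inner)
    then show ?thesis
      unfolding True[symmetric] diag[OF Herm_jordan_prod[OF x y]]
      using Herm_diagonal[OF Herm_jordan_prod[OF x y], of i]
        Herm_diagonal[OF Herm_jordan_prod[OF herm[OF x] herm[OF y]], of i] by simp
  next
    case False
    then have "mprod (phase_act U x) (phase_act U y) $ i $ j = (U i * (mprod x y $ i $ j)) * hconj (U j)"
      "mprod (phase_act U y) (phase_act U x) $ i $ j = (U i * (mprod y x $ i $ j)) * hconj (U j)"
      using x y by (simp_all add: mprod_def off_prod hmult_sum_left hmult_sum_right)
    then show ?thesis
      by (simp add: jordan_prod_def phase_act_def hmult_scaleR_right hmult_scaleR_left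
          hmult_add_right hmult_add_left)
  qed
  then show ?thesis
    unfolding jordan_isometry_def by (simp add: vec_eq_iff herm mtrace_def diag)
qed

text \<open>The left, right and middle Moufang identities, arranged as the compatibility conditions for
phases that are \<open>u\<close>, \<open>1\<close> and the conjugate of \<open>u\<close> in some order.\<close>

lemma autotopy_triples:
  fixes u a b :: 'k
  assumes u: "hinner u u = 1"
  shows "((u * a) * u) * (hconj u * b) = u * (a * b)"
    and "(a * hconj u) * ((u * b) * u) = (a * b) * u"
    and "(u * a) * (b * u) = (u * (a * b)) * u"
proof -
  have u': "hinner (hconj u) (hconj u) = 1" using u by (simp add: hinner_hconj)
  have "u * (hconj u * b) = b"
    using hconj_mult_cancel_left[of "hconj u" b] u' by (simp add: hconj_hconj)
  then show "((u * a) * u) * (hconj u * b) = u * (a * b)" by (simp add: moufang_left)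
  have "(a * hconj u) * u = a"
    using mult_hconj_cancel_right[of a "hconj u"] u' by (simp add: hconj_hconj)
  then show "(a * hconj u) * ((u * b) * u) = (a * b) * u" by (simp add: moufang_right)
  show "(u * a) * (b * u) = (u * (a * b)) * u" by (rule moufang_middle)
qed

lemma make_entry_real:
  fixes x :: "'k^'n^'n"
  assumes scope: "(\<forall>a b c :: 'k. (a * b) * c = a * (b * c)) \<or> CARD('n) = 3"
    and x: "x \<in> Herm" and pq: "p \<noteq> q"
  obtains T :: "'k^'n^'n \<Rightarrow> 'k^'n^'n" where "jordan_isometry T"
    "\<forall>i. T x $ i $ i = x $ i $ i" "T x $ p $ q = sqrt (hinner (x $ p $ q) (x $ p $ q)) *\<^sub>R 1"
proof -
  define a where "a = x $ p $ q"
  \<comment> \<open>Multiplying \<open>a\<close> from the left by its normalised conjugate turns it into its norm.\<close>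
  define u where "u = (if a = 0 then 1 else (1 / sqrt (hinner a a)) *\<^sub>R hconj a)"
  have u: "hinner u u = 1"
    using hinner_self_pos[of a]
    by (auto simp: u_def hinner_scaleR_left hinner_scaleR_right hinner_hconj hinner_one_one)
  have u': "hinner (hconj u) (hconj u) = 1" using u by (simp add: hinner_hconj)
  have ua: "u * a = sqrt (hinner a a) *\<^sub>R 1"
    using hinner_self_pos[of a]
    by (auto simp: u_def hmult_scaleR_left hconj_mult_self hmult_one_left hinner_zero_left
        real_div_sqrt)
  \<comment> \<open>With three indices, the one besides \<open>p\<close> and \<open>q\<close> receives the conjugate of \<open>u\<close>, as
    the Moufang identities demand.\<close>
  define U where "U i = (if i = p then u else if i = q then 1 else hconj u)" for i
  have unit: "hinner (U i) (U i) = 1" for i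
    by (simp add: U_def u u' hinner_one_one)
  have assoc2: "(U i * a) * hconj (U j) = U i * (a * hconj (U j))" for i j a
    using flexible_hconj[of u] flexible_hconj[of "hconj u"] flexible[of u] flexible[of "hconj u"]
    by (simp add: U_def hconj_hconj hconj_one hmult_one_left hmult_one_right)
  have autotopy: "((U i * a) * hconj (U l)) * ((U l * b) * hconj (U j)) = (U i * (a * b)) * hconj (U j)"
    if dist: "i \<noteq> l" "l \<noteq> j" "i \<noteq> j" for i l j a b
    using scope
  proof
    assume assoc: "\<forall>a b c :: 'k. (a * b) * c = a * (b * c)"
    then have assoc': "(a * b) * c = a * (b * c)" for a b c :: 'k by blast
    have cancel: "hconj (U l) * (U l * c) = c" for c
      using hconj_mult_cancel_left[of "U l" c] unit[of l] by simp
    show ?thesis by (simp only: assoc' cancel)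
  next
    assume card: "CARD('n) = 3"
    \<comment> \<open>So \<open>p\<close> and \<open>q\<close> occur among the three indices, and the six ways in which they
      do so are the three triples for \<open>u\<close> and the three for its conjugate.\<close>
    have "{i, l, j} = UNIV"
      by (rule card_subset_eq) (use dist card in auto)
    then have "p \<in> {i, l, j}" "q \<in> {i, l, j}" by auto
    then have "p = i \<and> q = l \<or> p = i \<and> q = j \<or> p = l \<and> q = i \<or> p = l \<and> q = j
        \<or> p = j \<and> q = i \<or> p = j \<and> q = l"
      using pq by auto
    then show ?thesis
      by (elim disjE) (use dist in \<open>simp_all add: U_def hconj_hconj hconj_one hmult_one_left
        hmult_one_right autotopy_triples[OF u] autotopy_triples[OF u', unfolded hconj_hconj]\<close>)
  qed
  have fixed: "phase_act U x $ i $ i = x $ i $ i" for i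
    by (rule phase_act_diagonal[OF unit x])
  have real: "phase_act U x $ p $ q = sqrt (hinner (x $ p $ q) (x $ p $ q)) *\<^sub>R 1"
    using pq ua by (simp add: phase_act_def U_def hconj_one hmult_one_right a_def)
  have "jordan_isometry (phase_act U)"
    by (rule jordan_isometry_phase_act) (fact unit, fact assoc2, fact autotopy)
  then show ?thesis by (rule that) (simp_all add: fixed real)
qed

section \<open>Approximate diagonalization\<close>

text \<open>Some off-diagonal entry carries at least the average of the off-diagonal mass; annihilating it
removes that share while the phases leave the diagonal alone.\<close>

lemma jacobi_step:
  fixes x :: "'k^'n^'n"
  assumes scope: "(\<forall>a b c :: 'k. (a * b) * c = a * (b * c)) \<or> CARD('n) = 3"
    and x: "x \<in> Herm"
  obtains T :: "'k^'n^'n \<Rightarrow> 'k^'n^'n" where "jordan_isometry T"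
    "minner (offdiag_part (T x)) (offdiag_part (T x))
       \<le> (1 - 1 / (real CARD('n))\<^sup>2) * minner (offdiag_part x) (offdiag_part x)"
proof (cases "minner (offdiag_part x) (offdiag_part x) = 0")
  case True
  then show ?thesis using that[OF jordan_isometry_id] by simp
next
  case False
  let ?off = "\<lambda>x::'k^'n^'n. minner (offdiag_part x) (offdiag_part x)"
  let ?f = "\<lambda>(i, j). hinner (offdiag_part x $ i $ j) (offdiag_part x $ i $ j)"
  have pos: "?off x > 0" using False minner_self_nonneg[of "offdiag_part x"] by simp
  have "\<exists>ij. ?off x / (real CARD('n))\<^sup>2 \<le> ?f ij"
  proof (rule ccontr)
    assume "\<not> ?thesis"
    then have "(\<Sum>ij\<in>UNIV. ?f ij) < (\<Sum>ij\<in>(UNIV :: ('n \<times> 'n) set). ?off x / (real CARD('n))\<^sup>2)"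
      by (intro sum_strict_mono) (auto simp: not_le)
    also have "\<dots> = ?off x" by (simp add: power2_eq_square)
    also have "\<dots> = (\<Sum>ij\<in>UNIV. ?f ij)"
      by (simp add: minner_def sum.cartesian_product flip: UNIV_Times_UNIV)
    finally show False by simp
  qed
  then obtain p q where max: "?off x / (real CARD('n))\<^sup>2 \<le> ?f (p, q)" by auto
  then have "?f (p, q) > 0" using pos
    by (smt (verit) zero_less_card_finite of_nat_0_less_iff zero_less_power divide_pos_pos)
  then have pq: "p \<noteq> q" by (auto simp: offdiag_part_def hinner_zero_left)
  let ?N = "hinner (x $ p $ q) (x $ p $ q)"
  have max': "?off x / (real CARD('n))\<^sup>2 \<le> ?N" using max pq by (simp add: offdiag_part_def)
  obtain S :: "'k^'n^'n \<Rightarrow> 'k^'n^'n" where S: "jordan_isometry S" "\<forall>i. S x $ i $ i = x $ i $ i"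
    "S x $ p $ q = sqrt ?N *\<^sub>R 1"
    by (rule make_entry_real[OF scope x pq])
  note Sx = jordan_isometry_Herm[OF S(1) x]
  obtain R :: "'k^'n^'n \<Rightarrow> 'k^'n^'n" where R: "jordan_isometry R"
    "(\<Sum>i\<in>UNIV. hinner (R (S x) $ i $ i) (R (S x) $ i $ i))
      = (\<Sum>i\<in>UNIV. hinner (S x $ i $ i) (S x $ i $ i)) + 2 * (sqrt ?N)\<^sup>2"
    by (rule annihilate_real_entry[OF Sx pq S(3)])
  have "?off (R (S x)) = ?off x - 2 * ?N"
    unfolding minner_offdiag_part R(2)
    using minner_jordan_isometry[OF R(1) Sx Sx] minner_jordan_isometry[OF S(1) x x]
    by (simp add: S(2) hinner_self_nonneg)
  also have "\<dots> \<le> (1 - 1 / (real CARD('n))\<^sup>2) * ?off x"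
    using max' hinner_self_nonneg[of "x $ p $ q"] by (simp add: algebra_simps)
  finally show ?thesis by (rule that[OF jordan_isometry_comp[OF R(1) S(1)]])
qed

lemma approximate_diagonalization:
  fixes x :: "'k^'n^'n"
  assumes scope: "(\<forall>a b c :: 'k. (a * b) * c = a * (b * c)) \<or> CARD('n) = 3"
    and x: "x \<in> Herm" and eps: "\<epsilon> > 0"
  obtains T :: "'k^'n^'n \<Rightarrow> 'k^'n^'n" where "jordan_isometry T"
    "minner (offdiag_part (T x)) (offdiag_part (T x)) < \<epsilon>"
proof -
  let ?off = "\<lambda>x::'k^'n^'n. minner (offdiag_part x) (offdiag_part x)"
  let ?r = "1 - 1 / (real CARD('n))\<^sup>2"
  have r: "0 \<le> ?r" "?r < 1" by (simp_all add: field_simps)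
  have iter: "\<exists>T :: 'k^'n^'n \<Rightarrow> 'k^'n^'n. jordan_isometry T \<and> ?off (T x) \<le> ?r ^ m * ?off x" for m
  proof (induction m)
    case 0
    then show ?case using jordan_isometry_id by fastforce
  next
    case (Suc m)
    then obtain T :: "'k^'n^'n \<Rightarrow> 'k^'n^'n" where T: "jordan_isometry T" "?off (T x) \<le> ?r ^ m * ?off x"
      by blast
    obtain S :: "'k^'n^'n \<Rightarrow> 'k^'n^'n" where S: "jordan_isometry S" "?off (S (T x)) \<le> ?r * ?off (T x)"
      by (rule jacobi_step[OF scope jordan_isometry_Herm[OF T(1) x]])
    have "?off (S (T x)) \<le> ?r ^ Suc m * ?off x"
      using S(2) mult_left_mono[OF T(2) r(1)] by (simp add: mult.assoc)
    then show ?case using jordan_isometry_comp[OF S(1) T(1)] by blast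
  qed
  have "(\<lambda>m. ?r ^ m * ?off x) \<longlonglongrightarrow> 0 * ?off x"
    using r by (intro tendsto_mult tendsto_const LIMSEQ_power_zero) simp
  then have "\<forall>\<^sub>F m in sequentially. ?r ^ m * ?off x < \<epsilon>"
    by (rule order_tendstoD) (use eps in simp)
  then obtain m where "?r ^ m * ?off x < \<epsilon>" by (auto simp: eventually_sequentially)
  then show ?thesis using iter[of m] that by force
qed

section \<open>The inequalities for general pairs\<close>

definition mnorm :: "'k^'n^'n \<Rightarrow> real" where "mnorm x = sqrt (minner x x)"

lemma mnorm_nonneg: "mnorm x \<ge> 0" 
  by (simp add: mnorm_def minner_self_nonneg)

lemma mnorm_power2: "(mnorm x)\<^sup>2 = minner x x"
  by (simp add: mnorm_def minner_self_nonneg)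

lemma abs_minner_le: "\<bar>minner x y\<bar> \<le> mnorm x * mnorm (y :: 'k^'n^'n)"
proof (rule power2_le_imp_le)
  show "\<bar>minner x y\<bar>\<^sup>2 \<le> (mnorm x * mnorm y)\<^sup>2"
    using gram_det_nonneg[of x y] by (simp add: power_mult_distrib mnorm_power2 gram_det_def)
qed (simp add: mnorm_nonneg)

lemma mnorm_jordan_prod_le:
  "mnorm (jordan_prod x y) \<le> real CARD('n) * mnorm x * mnorm (y :: 'k^'n^'n)"
proof (rule power2_le_imp_le)
  have "(mnorm (jordan_prod x y))\<^sup>2 \<le> real CARD('n) * (minner x x * minner y y)"
    by (simp add: mnorm_power2 minner_jordan_prod_le)
  also have "\<dots> \<le> (real CARD('n))\<^sup>2 * (minner x x * minner y y)"
    by (intro mult_right_mono mult_nonneg_nonneg minner_self_nonneg) (simp add: power2_eq_square)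
  finally show "(mnorm (jordan_prod x y))\<^sup>2 \<le> (real CARD('n) * mnorm x * mnorm y)\<^sup>2"
    by (simp add: power_mult_distrib mnorm_power2 mult.assoc)
qed (simp add: mnorm_nonneg)

lemma mnorm_diag_part_le: "mnorm (diag_part x) \<le> mnorm x"
  using minner_self_split[of x] minner_self_nonneg[of "offdiag_part x"] by (simp add: mnorm_def)

text \<open>Writing the matrix as diagonal plus off-diagonal part, the difference is a sum of four inner
products of Jordan products, each having the off-diagonal part as one of its factors.\<close>

lemma jordan_defect_diag_part:
  fixes x y :: "'k^'n^'n"
  shows "\<bar>jordan_defect x y - jordan_defect (diag_part x) y\<bar>
    \<le> 4 * (real CARD('n))\<^sup>2 * (mnorm x * mnorm (offdiag_part x) * (mnorm y)\<^sup>2)"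
proof -
  let ?d = "diag_part x" and ?o = "offdiag_part x" and ?n = "real CARD('n)"
  let ?Y = "jordan_prod y y" and ?R = "jordan_prod ?o y"
  let ?B = "mnorm x * mnorm ?o * (mnorm y)\<^sup>2"
  have xd: "jordan_prod x z = jordan_prod ?d z + jordan_prod ?o z" for z
    by (metis diag_plus_offdiag jordan_prod_add_left)
  have xx: "jordan_prod x x = jordan_prod ?d ?d + jordan_prod ?o ?d + jordan_prod x ?o"
    using xd[of ?d] jordan_prod_add_right[of x ?d ?o] by (simp add: diag_plus_offdiag)
  have diff: "jordan_defect x y - jordan_defect ?d y
     = minner (jordan_prod ?o ?d) ?Y + minner (jordan_prod x ?o) ?Y
       - minner ?R (jordan_prod x y) - minner ?R (jordan_prod ?d y)"
    unfolding jordan_defect_def xx xd[of y]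
    by (simp add: minner_bilinear minner_commute[of "jordan_prod ?d y" ?R])
  note nn = mnorm_nonneg[of x] mnorm_nonneg[of ?o] mnorm_nonneg[of y] mnorm_nonneg[of ?d]
  have key: "\<bar>minner (jordan_prod a b) (jordan_prod c e)\<bar>
      \<le> ?n\<^sup>2 * (mnorm a * mnorm b * (mnorm c * mnorm e))" for a b c e :: "'k^'n^'n"
  proof -
    have "\<bar>minner (jordan_prod a b) (jordan_prod c e)\<bar>
        \<le> mnorm (jordan_prod a b) * mnorm (jordan_prod c e)" by (rule abs_minner_le)
    also have "\<dots> \<le> (?n * mnorm a * mnorm b) * (?n * mnorm c * mnorm e)"
      by (intro mult_mono mnorm_jordan_prod_le mnorm_nonneg mult_nonneg_nonneg) simp_all
    finally show ?thesis by (simp add: power2_eq_square mult_ac)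
  qed
  have "mnorm ?o * mnorm ?d * (mnorm y * mnorm y) \<le> mnorm ?o * mnorm x * (mnorm y * mnorm y)"
    by (intro mult_right_mono mult_left_mono mnorm_diag_part_le mult_nonneg_nonneg nn)
  then have d: "mnorm ?o * mnorm ?d * (mnorm y * mnorm y) \<le> ?B"
    by (simp add: power2_eq_square mult_ac)
  have d': "?n\<^sup>2 * (mnorm ?o * mnorm ?d * (mnorm y * mnorm y)) \<le> ?n\<^sup>2 * ?B"
    by (rule mult_left_mono[OF d]) simp
  have "\<bar>minner (jordan_prod ?o ?d) ?Y\<bar> \<le> ?n\<^sup>2 * ?B"
    using key[of ?o ?d y y] d' by linarith
  moreover have "\<bar>minner (jordan_prod x ?o) ?Y\<bar> \<le> ?n\<^sup>2 * ?B"
    using key[of x ?o y y] by (simp add: power2_eq_square)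
  moreover have "\<bar>minner ?R (jordan_prod x y)\<bar> \<le> ?n\<^sup>2 * ?B"
    using key[of ?o y x y] by (simp add: power2_eq_square mult_ac)
  moreover have "\<bar>minner ?R (jordan_prod ?d y)\<bar> \<le> ?n\<^sup>2 * ?B"
    using key[of ?o y ?d y] d' by (simp add: mult_ac)
  ultimately show ?thesis unfolding diff by linarith
qed

text \<open>The Gram determinant of the off-diagonal part appears in the difference with a favourable sign,
so only the mixed term has to be estimated.\<close>

lemma gram_det_diag_part:
  fixes x y :: "'k^'n^'n"
  shows "gram_det (diag_part x) y \<le> gram_det x y + 2 * (mnorm x * mnorm (offdiag_part x) * (mnorm y)\<^sup>2)"
proof -
  let ?d = "diag_part x" and ?o = "offdiag_part x"
  have ip: "minner x y = minner ?d y + minner ?o y"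
    by (metis diag_plus_offdiag minner_add_left)
  have "gram_det x y - gram_det ?d y = gram_det ?o y - 2 * (minner ?d y * minner ?o y)"
    unfolding gram_det_def ip minner_self_split[of x]
    by (simp add: power2_eq_square algebra_simps)
  moreover have "minner ?d y * minner ?o y \<le> mnorm x * mnorm ?o * (mnorm y)\<^sup>2"
  proof -
    have "minner ?d y * minner ?o y \<le> \<bar>minner ?d y\<bar> * \<bar>minner ?o y\<bar>"
      by (metis abs_ge_self abs_mult)
    also have "\<dots> \<le> (mnorm ?d * mnorm y) * (mnorm ?o * mnorm y)"
      by (intro mult_mono abs_minner_le mult_nonneg_nonneg mnorm_nonneg) simp
    also have "\<dots> \<le> (mnorm x * mnorm y) * (mnorm ?o * mnorm y)"
      by (intro mult_right_mono mnorm_diag_part_le mult_nonneg_nonneg mnorm_nonneg)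
    finally show ?thesis by (simp add: power2_eq_square mult_ac)
  qed
  ultimately show ?thesis using gram_det_nonneg[of ?o y] by linarith
qed

text \<open>In the upper bound only the off-diagonal part of \<open>y\<close> contributes to the defect, whereas the
diagonal part of \<open>y\<close> contributes to the Gram determinant a nonnegative amount by
Cauchy--Schwarz.\<close>

lemma jordan_defect_diagonal_bounds:
  fixes x y :: "'k^'n^'n"
  assumes x: "x \<in> Herm" and y: "y \<in> Herm"
  shows "0 \<le> jordan_defect (diag_part x) y" "2 * jordan_defect (diag_part x) y \<le> gram_det (diag_part x) y"
proof -
  let ?d = "diag_part x"
  define e where "e i = hre (x $ i $ i)" for i
  let ?N = "\<lambda>i j. hinner (y $ i $ j) (y $ i $ j)"
  have d: "?d $ i $ j = (if i = j then e i *\<^sub>R 1 else 0)" for i j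
    using Herm_diagonal[OF x, of j] by (simp add: diag_part_def e_def)
  note Q = jordan_defect_diagonal[of ?d e y, OF d y]
  show "0 \<le> jordan_defect ?d y"
    unfolding Q by (intro sum_nonneg mult_nonneg_nonneg hinner_self_nonneg) simp
  have dd: "minner ?d ?d = (\<Sum>i\<in>UNIV. (e i)\<^sup>2)"
    unfolding minner_diag_part
    using Herm_diagonal[OF x] by (intro sum.cong refl)
      (metis e_def hinner_scaleR_left hinner_scaleR_right hinner_one_one mult.right_neutral power2_eq_square)
  have le: "(e i - e j)\<^sup>2 \<le> 2 * minner ?d ?d" if "i \<noteq> j" for i j
  proof -
    have "(e i)\<^sup>2 + (e j)\<^sup>2 = (\<Sum>l\<in>{i, j}. (e l)\<^sup>2)" using that by simp
    also have "\<dots> \<le> minner ?d ?d" unfolding dd by (intro sum_mono2) auto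
    finally have "2 * ((e i)\<^sup>2 + (e j)\<^sup>2) \<le> 2 * minner ?d ?d" by simp
    moreover have "(e i - e j)\<^sup>2 \<le> 2 * ((e i)\<^sup>2 + (e j)\<^sup>2)"
      using zero_le_power2[of "e i + e j"] by (simp add: power2_eq_square algebra_simps)
    ultimately show ?thesis by (rule order_trans[rotated])
  qed
  have "jordan_defect ?d y \<le> (\<Sum>i\<in>UNIV. \<Sum>j\<in>UNIV. minner ?d ?d / 2 *
      hinner (offdiag_part y $ i $ j) (offdiag_part y $ i $ j))"
    unfolding Q
  proof (intro sum_mono)
    fix i j
    show "(e i - e j)\<^sup>2 / 4 * ?N i j \<le> minner ?d ?d / 2 * hinner (offdiag_part y $ i $ j) (offdiag_part y $ i $ j)"
    proof (cases "i = j")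
      case True
      then show ?thesis by (simp add: offdiag_part_def hinner_zero_left)
    next
      case False
      then show ?thesis using mult_right_mono[OF le[OF False] hinner_self_nonneg[of "y $ i $ j"]]
        by (simp add: offdiag_part_def)
    qed
  qed
  also have "\<dots> = minner ?d ?d * minner (offdiag_part y) (offdiag_part y) / 2"
    by (simp add: minner_def[of "offdiag_part y"] sum_distrib_left sum_divide_distrib)
  finally have "2 * jordan_defect ?d y \<le> minner ?d ?d * minner (offdiag_part y) (offdiag_part y)" by simp
  moreover have "minner ?d y = minner ?d (diag_part y)"
    unfolding minner_def by (intro sum.cong refl) (simp add: diag_part_def hinner_zero_left)
  moreover have "0 \<le> gram_det ?d (diag_part y)" by (rule gram_det_nonneg)
  ultimately show "2 * jordan_defect ?d y \<le> gram_det ?d y"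
    unfolding gram_det_def minner_self_split[of y] by (simp add: algebra_simps)
qed

lemma jordan_defect_bounds:
  fixes x y :: "'k^'n^'n"
  assumes scope: "(\<forall>a b c :: 'k. (a * b) * c = a * (b * c)) \<or> CARD('n) = 3"
    and x: "x \<in> Herm" and y: "y \<in> Herm"
  shows "0 \<le> jordan_defect x y" "2 * jordan_defect x y \<le> gram_det x y"
proof -
  let ?C = "4 * (real CARD('n))\<^sup>2"
  let ?M = "mnorm x * (mnorm y)\<^sup>2"
  have M: "?M \<ge> 0" by (simp add: mnorm_nonneg)
  have approx: "- (?C * (?M * \<epsilon>)) \<le> jordan_defect x y \<and>
      2 * jordan_defect x y \<le> gram_det x y + (2 + 2 * ?C) * (?M * \<epsilon>)" if eps: "\<epsilon> > 0" for \<epsilon>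
  proof -
    obtain T :: "'k^'n^'n \<Rightarrow> 'k^'n^'n" where T: "jordan_isometry T"
      and off: "minner (offdiag_part (T x)) (offdiag_part (T x)) < \<epsilon>\<^sup>2"
      by (rule approximate_diagonalization[OF scope x, of "\<epsilon>\<^sup>2"]) (use eps in auto)
    note Tx = jordan_isometry_Herm[OF T x] and Ty = jordan_isometry_Herm[OF T y]
    have "mnorm (offdiag_part (T x)) \<le> \<epsilon>"
      using off eps by (simp add: mnorm_def real_le_lsqrt)
    moreover have "mnorm (T x) = mnorm x" "mnorm (T y) = mnorm y"
      by (simp_all add: mnorm_def minner_jordan_isometry[OF T] x y)
    ultimately have B: "mnorm (T x) * mnorm (offdiag_part (T x)) * (mnorm (T y))\<^sup>2 \<le> ?M * \<epsilon>"
      using mult_left_mono[OF _ M, of "mnorm (offdiag_part (T x))" \<epsilon>] by (simp add: mult_ac)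
    have "\<bar>jordan_defect x y - jordan_defect (diag_part (T x)) (T y)\<bar> \<le> ?C * (?M * \<epsilon>)"
      using order_trans[OF jordan_defect_diag_part[of "T x" "T y"] mult_left_mono[OF B, of ?C]]
        jordan_defect_jordan_isometry[OF T x y] by simp
    moreover have "gram_det (diag_part (T x)) (T y) \<le> gram_det x y + 2 * (?M * \<epsilon>)"
      using gram_det_diag_part[of "T x" "T y"] gram_det_jordan_isometry[OF T x y] B by simp
    ultimately show ?thesis
      using jordan_defect_diagonal_bounds[OF Tx Ty] by (auto simp: algebra_simps)
  qed
  \<comment> \<open>Both claims follow by letting the error \<open>\<epsilon>\<close> tend to zero.\<close>
  have small: "a \<le> b" if "\<And>\<epsilon>. \<epsilon> > 0 \<Longrightarrow> a \<le> b + K * \<epsilon>" "K \<ge> 0" for a b K :: real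
  proof (rule field_le_epsilon)
    fix \<delta> :: real assume \<delta>: "\<delta> > 0"
    have "K * (\<delta> / (K + 1)) \<le> \<delta>" using \<delta> that(2) by (simp add: field_simps)
    then show "a \<le> b + \<delta>" using that(1)[of "\<delta> / (K + 1)"] \<delta> that(2) by (simp add: add_nonneg_pos) 
  qed
  show "0 \<le> jordan_defect x y"
  proof (rule small[of _ _ "?C * ?M"])
    show "0 \<le> jordan_defect x y + ?C * ?M * \<epsilon>" if "\<epsilon> > 0" for \<epsilon>
      using approx[OF that] by (simp only: mult.assoc) linarith
  qed (use M in simp)
  show "2 * jordan_defect x y \<le> gram_det x y"
  proof (rule small[of _ _ "(2 + 2 * ?C) * ?M"])
    show "2 * jordan_defect x y \<le> gram_det x y + (2 + 2 * ?C) * ?M * \<epsilon>" if "\<epsilon> > 0" for \<epsilon>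
      using approx[OF that] by (simp only: mult.assoc)
  qed (use M in simp)
qed

end

section \<open>The Hurwitz algebras\<close>

lemma hinner_CD: "hinner (CD a b) (CD c d) = hinner a c + hinner b d"
  by (simp add: hinner_def cd_defs hmult_minus_left hconj_minus hre_add hre_mult_commute)

text \<open>The norms and traces of the scalars are real and hence central, which is all that separates the
two bracketings once the products are expanded.\<close>

lemma alternative_conj_algebra_cayley_dickson:
  assumes assoc: "\<And>a b c :: 'a::conj_algebra. (a * b) * c = a * (b * c)"
    and pos: "\<And>a :: 'a. a \<noteq> 0 \<Longrightarrow> hinner a a > 0"
  shows "alternative_conj_algebra TYPE('a cayley_dickson)"
proof
  fix p q :: "'a cayley_dickson"
  obtain a b where p: "p = CD a b" by (cases p)
  obtain c d where q: "q = CD c d" by (cases q)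
  have norm: "b * (hconj b * z) = hinner b b *\<^sub>R z" "hconj b * (b * z) = hinner b b *\<^sub>R z" for z
    by (simp_all add: assoc[symmetric] mult_hconj_self hconj_mult_self hmult_scaleR_left hmult_one_left)
  show "p * (p * q) = (p * p) * q"
    unfolding p q
    by (simp add: cd_defs hmult_add_left hmult_add_right hmult_diff_left hmult_diff_right hconj_add
        hconj_diff hconj_mult hconj_hconj assoc norm mult_hconj_self hconj_mult_self hconj_eq[of a]
        hmult_scaleR_left hmult_scaleR_right hmult_one_left hmult_one_right)
next
  fix p :: "'a cayley_dickson"
  assume nz: "p \<noteq> 0"
  obtain a b where p: "p = CD a b" by (cases p)
  have nonneg: "hinner z z \<ge> 0" for z :: 'a
    using pos[of z] by (cases "z = 0") (auto simp: hinner_zero_left)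
  have "a \<noteq> 0 \<or> b \<noteq> 0" using nz by (auto simp: p zero_cayley_dickson_def)
  then show "hinner p p > 0"
    unfolding p hinner_CD using pos[of a] pos[of b] nonneg[of a] nonneg[of b] by auto
qed

lemma hinner_complex_pos: "(a::complex) \<noteq> 0 \<Longrightarrow> hinner a a > 0"
  by (simp add: hinner_def hconj_complex_def hre_complex_def complex_eq_iff sum_squares_gt_zero_iff)

lemma quaternion_associative: "((a::quaternion) * b) * c = a * (b * c)"
  by (simp add: cd_defs hconj_complex_def algebra_simps)

lemma alternative_conj_algebra_real: "alternative_conj_algebra TYPE(real)"
  by standard (simp_all add: hinner_def hconj_real_def hre_real_def flip: power2_eq_square)

lemma alternative_conj_algebra_complex: "alternative_conj_algebra TYPE(complex)"
  by standard (simp_all add: hinner_complex_pos)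

lemma alternative_conj_algebra_quaternion: "alternative_conj_algebra TYPE(quaternion)"
  by (rule alternative_conj_algebra_cayley_dickson) (simp_all add: hinner_complex_pos)

lemma alternative_conj_algebra_octonion: "alternative_conj_algebra TYPE(octonion)"
  by (rule alternative_conj_algebra_cayley_dickson) (use alternative_conj_algebra_quaternion in
     \<open>simp_all add: quaternion_associative alternative_conj_algebra_def\<close>)

lemma alternative_conj_algebra_isomorphic:
  assumes iso: "conj_algebra_isomorphic TYPE('a::conj_algebra) TYPE('b::conj_algebra)"
    and alt: "alternative_conj_algebra TYPE('b)"
  shows "alternative_conj_algebra TYPE('a)"
proof -
  interpret b: alternative_conj_algebra "TYPE('b)" by (rule alt)
  obtain f :: "'a \<Rightarrow> 'b" where f: "linear f" "bij f" "f 1 = 1" "\<And>a b. f (a * b) = f a * f b"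
    "\<And>a. f (hconj a) = hconj (f a)"
    using iso unfolding conj_algebra_isomorphic_def by blast
  have inj: "f a = f b \<Longrightarrow> a = b" for a b using f(2) by (simp add: bij_def inj_def)
  have hre: "hre (f a) = hre a" for a
  proof -
    have "(2 * hre (f a)) *\<^sub>R (1::'b) = f (a + hconj a)"
      by (simp add: add_hconj[symmetric] linear_add[OF f(1)] f(5))
    also have "\<dots> = (2 * hre a) *\<^sub>R 1"
      by (simp add: add_hconj linear_cmul[OF f(1)] f(3))
    finally show ?thesis using hre_eqI by fastforce
  qed
  show ?thesis
  proof
    show "(a::'a) * (a * b) = (a * a) * b" for a b
      by (rule inj) (simp add: f(4) b.left_alternative)
    show "hinner a a > 0" if "a \<noteq> 0" for a :: 'a
    proof -
      have "f a \<noteq> 0" using that inj[of a 0] linear_0[OF f(1)] by auto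
      then have "hinner (f a) (f a) > 0" by (rule b.hinner_self_pos)
      then show ?thesis by (simp add: hinner_def hre flip: f(4,5))
    qed
  qed
qed

lemma associative_isomorphic:
  assumes iso: "conj_algebra_isomorphic TYPE('a::conj_algebra) TYPE('b::conj_algebra)"
    and assoc: "\<And>a b c :: 'b. (a * b) * c = a * (b * c)"
  shows "((a::'a) * b) * c = a * (b * c)"
proof -
  obtain f :: "'a \<Rightarrow> 'b" where f: "bij f" "\<And>a b. f (a * b) = f a * f b"
    using iso unfolding conj_algebra_isomorphic_def by blast
  have "f ((a * b) * c) = f (a * (b * c))" by (simp add: f(2) assoc)
  then show ?thesis using f(1) by (simp add: bij_def inj_def)
qed

section \<open>Equality cases\<close>

definition diag_mat :: "('n \<Rightarrow> real) \<Rightarrow> 'k::conj_algebra^'n^'n" where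
  "diag_mat e = (\<chi> i j. if i = j then e i *\<^sub>R 1 else 0)"

lemma diag_mat_nth: "diag_mat e $ i $ j = (if i = j then e i *\<^sub>R 1 else 0)"
  by (simp add: diag_mat_def)

definition swap_mat :: "'n \<Rightarrow> 'n \<Rightarrow> 'k::conj_algebra^'n^'n" where
  "swap_mat p q = (\<chi> i j. if i = p \<and> j = q \<or> i = q \<and> j = p then 1 else 0)"

text \<open>The diagonal of \<open>E\<^sub>p\<^sub>p - E\<^sub>q\<^sub>q\<close>.\<close>

abbreviation unit_diff :: "'n \<Rightarrow> 'n \<Rightarrow> 'n \<Rightarrow> real" where
  "unit_diff p q i \<equiv> (if i = p then 1 else 0) - (if i = q then 1 else 0)"

lemma sum_unit_diff: "(\<Sum>i\<in>UNIV. unit_diff p q i * g i) = g p - g (q :: 'n::finite)"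
  by (simp add: left_diff_distrib sum_subtractf if_distribR if_distrib[where f = "(*)"] cong: if_cong)

lemma diag_mat_Herm0:
  assumes "(\<Sum>i\<in>UNIV. e i) = 0"
  shows "diag_mat e \<in> (Herm0 :: ('k::conj_algebra^'n^'n) set)"
proof -
  have "mtrace (diag_mat e :: 'k^'n^'n) = (\<Sum>i\<in>UNIV. e i) *\<^sub>R 1"
    by (simp add: mtrace_def diag_mat_def scaleR_left.sum)
  then show ?thesis
    using assms by (auto simp: Herm0_def Herm_iff diag_mat_def hconj_scaleR hconj_one hconj_zero)
qed

lemma unit_diff_Herm0: "diag_mat (unit_diff p q) \<in> (Herm0 :: ('k::conj_algebra^'n^'n) set)"
  using sum_unit_diff[of p q "\<lambda>_. 1"] by (intro diag_mat_Herm0) simp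

lemma minner_diag_mat: "minner (diag_mat e :: 'k::conj_algebra^'n^'n) (diag_mat g) = (\<Sum>i\<in>UNIV. e i * g i)"
proof -
  have "hinner (diag_mat e $ i $ j :: 'k) (diag_mat g $ i $ j) = (if j = i then e i * g i else 0)" for i j
    by (simp add: diag_mat_def hinner_scaleR_left hinner_scaleR_right hinner_one_one hinner_zero_left)
  then show ?thesis by (simp add: minner_def)
qed

lemma minner_unit_diff: "minner (diag_mat (unit_diff p q)) (diag_mat g) = g p - g q"
  unfolding minner_diag_mat by (rule sum_unit_diff)

context alternative_conj_algebra
begin

lemma commuting_witness:
  fixes p q r :: "'n::finite"
  assumes "p \<noteq> q" "q \<noteq> r" "p \<noteq> r"
  obtains x y :: "'k^'n^'n" where "x \<in> Herm0" "y \<in> Herm0" "lin_indep_pair x y" "herm_sect x y = -1"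
proof -
  let ?x = "diag_mat (unit_diff p q) :: 'k^'n^'n" and ?y = "diag_mat (unit_diff q r) :: 'k^'n^'n"
  have H: "?x \<in> Herm0" "?y \<in> Herm0" by (rule unit_diff_Herm0)+
  then have H': "?x \<in> Herm" "?y \<in> Herm" by (simp_all add: Herm0_def)
  have gram: "gram_det ?x ?y = 3"
    using assms by (simp add: gram_det_def minner_unit_diff)
  have "jordan_defect ?x ?y = 0"
    unfolding jordan_defect_diagonal[OF diag_mat_nth H'(2)]
    by (intro sum.neutral ballI) (auto simp: diag_mat_nth hinner_zero_left)
  then have "herm_sect ?x ?y = -1" using herm_sect_eq[OF H'] gram by simp
  then show ?thesis using that[OF H] gram by (simp add: lin_indep_pair_iff_gram_det)
qed

lemma extremal_witness:
  fixes p q :: "'n::finite"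
  assumes pq: "p \<noteq> q"
  obtains x y :: "'k^'n^'n" where "x \<in> Herm0" "y \<in> Herm0" "lin_indep_pair x y"
    "herm_sect x y = (real CARD('n) - 2) / 2"
proof -
  let ?x = "diag_mat (unit_diff p q) :: 'k^'n^'n" and ?y = "swap_mat p q :: 'k^'n^'n"
  have x0: "?x \<in> Herm0" by (rule unit_diff_Herm0)
  have y0: "?y \<in> Herm0"
    using pq by (auto simp: Herm0_def Herm_iff swap_mat_def hconj_one hconj_zero mtrace_def
        intro!: sum.neutral)
  have H: "?x \<in> Herm" "?y \<in> Herm" using x0 y0 by (simp_all add: Herm0_def)
  have "hinner (?y $ i $ j) (?y $ i $ j)
      = (if j = q then if i = p then 1 else 0 else 0) + (if j = p then if i = q then 1 else 0 else 0)" for i j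
    using pq by (auto simp: swap_mat_def hinner_one_one hinner_zero_left)
  then have sum: "(\<Sum>i\<in>UNIV. \<Sum>j\<in>UNIV. g i j * hinner (?y $ i $ j) (?y $ i $ j)) = g p q + g q p"
    for g :: "'n \<Rightarrow> 'n \<Rightarrow> real"
    by (simp add: distrib_left sum.distrib if_distrib[where f = "(*) _"] cong: if_cong)
  have xx: "minner ?x ?x = 2" using pq by (simp add: minner_unit_diff)
  have yy: "minner ?y ?y = 2" using sum[of "\<lambda>_ _. 1"] by (simp add: minner_def)
  have xy: "minner ?x ?y = 0" unfolding minner_def using pq
    by (intro sum.neutral ballI) (auto simp: diag_mat_def swap_mat_def hinner_zero_left hinner_zero_right)
  have gram: "gram_det ?x ?y = 4" by (simp add: gram_det_def xx yy xy)
  have "jordan_defect ?x ?y = 2"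
    unfolding jordan_defect_diagonal[OF diag_mat_nth H(2)] sum using pq by simp
  then have "herm_sect ?x ?y = (real CARD('n) - 2) / 2"
    using herm_sect_eq[OF H] gram by (simp add: field_simps)
  then show ?thesis using that[OF x0 y0] gram by (simp add: lin_indep_pair_iff_gram_det)
qed

lemma herm_sect_bounds:
  fixes x y :: "'k^'n^'n"
  assumes scope: "(\<forall>a b c :: 'k. (a * b) * c = a * (b * c)) \<or> CARD('n) = 3"
    and x: "x \<in> Herm" and y: "y \<in> Herm" and ind: "lin_indep_pair x y"
  shows "-1 \<le> herm_sect x y" "herm_sect x y \<le> (real CARD('n) - 2) / 2"
proof -
  have pos: "gram_det x y > 0" using ind by (simp add: lin_indep_pair_iff_gram_det)
  then have sect: "herm_sect x y = real CARD('n) * jordan_defect x y / gram_det x y - 1"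
    using herm_sect_eq[OF x y] by simp
  note bounds = jordan_defect_bounds[OF scope x y]
  show "-1 \<le> herm_sect x y" unfolding sect using pos bounds(1) by simp
  have "real CARD('n) * jordan_defect x y \<le> real CARD('n) * (gram_det x y / 2)"
    using bounds(2) by (intro mult_left_mono) simp_all
  then have "real CARD('n) * jordan_defect x y / gram_det x y \<le> real CARD('n) / 2"
    using pos by (simp add: divide_le_eq)
  then show "herm_sect x y \<le> (real CARD('n) - 2) / 2" unfolding sect by (simp add: field_simps)
qed

end

theorem corollary9p19:
  assumes hurwitz: "conj_algebra_isomorphic TYPE('k::conj_algebra) TYPE(real) \<or>
      conj_algebra_isomorphic TYPE('k) TYPE(complex) \<or>
      conj_algebra_isomorphic TYPE('k) TYPE(quaternion) \<or>
      conj_algebra_isomorphic TYPE('k) TYPE(octonion)"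
    and rank: "CARD('n::finite) \<ge> 2"
    and rank_oct: "conj_algebra_isomorphic TYPE('k) TYPE(octonion) \<Longrightarrow> CARD('n) = 3"
  shows "(\<forall>x\<in>Herm0. \<forall>y\<in>Herm0. lin_indep_pair x y \<longrightarrow>
            -1 \<le> herm_sect x (y :: 'k^'n^'n) \<and> herm_sect x y \<le> (real CARD('n) - 2) / 2) \<and>
         (CARD('n) \<ge> 3 \<longrightarrow>
            (\<exists>x\<in>Herm0. \<exists>y\<in>Herm0. lin_indep_pair x y \<and> herm_sect x (y :: 'k^'n^'n) = -1)) \<and>
         (\<exists>x\<in>Herm0. \<exists>y\<in>Herm0. lin_indep_pair x y \<and>
            herm_sect x (y :: 'k^'n^'n) = (real CARD('n) - 2) / 2) \<and>
         ((\<forall>a b c :: 'k. (a * b) * c = a * (b * c)) \<longrightarrow>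
            (\<forall>x\<in>Herm0. \<forall>y\<in>Herm0. \<forall>z\<in>Herm0.
               associator herm_circ x y (z :: 'k^'n^'n) =
                 (1/4) *\<^sub>R mcommutator y (mcommutator x z)
                 - herm_metric x y *\<^sub>R z + herm_metric y z *\<^sub>R x))"
proof -
  have "alternative_conj_algebra TYPE('k)"
    using hurwitz
    by (elim disjE alternative_conj_algebra_isomorphic[OF _ alternative_conj_algebra_real]
        alternative_conj_algebra_isomorphic[OF _ alternative_conj_algebra_complex]
        alternative_conj_algebra_isomorphic[OF _ alternative_conj_algebra_quaternion]
        alternative_conj_algebra_isomorphic[OF _ alternative_conj_algebra_octonion])
  then interpret alternative_conj_algebra "TYPE('k)" .
  have scope: "(\<forall>a b c :: 'k. (a * b) * c = a * (b * c)) \<or> CARD('n) = 3"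
    using hurwitz
  proof (elim disjE)
    assume "conj_algebra_isomorphic TYPE('k) TYPE(real)"
    from associative_isomorphic[OF this] show ?thesis by simp
  next
    assume "conj_algebra_isomorphic TYPE('k) TYPE(complex)"
    from associative_isomorphic[OF this] show ?thesis by simp
  next
    assume "conj_algebra_isomorphic TYPE('k) TYPE(quaternion)"
    from associative_isomorphic[OF this quaternion_associative] show ?thesis by blast
  next
    assume "conj_algebra_isomorphic TYPE('k) TYPE(octonion)"
    then show ?thesis using rank_oct by blast
  qed
  obtain p q :: 'n where pq: "p \<noteq> q"
    using rank card_le_Suc0_iff_eq[of "UNIV :: 'n set"] by auto
  have "\<exists>x\<in>Herm0. \<exists>y\<in>Herm0. lin_indep_pair x y \<and> herm_sect x (y :: 'k^'n^'n) = -1"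
    if "CARD('n) \<ge> 3"
  proof -
    have "UNIV \<noteq> {p, q}"
    proof
      assume "UNIV = {p, q}"
      then have "CARD('n) = card {p, q}" by (rule arg_cong)
      then show False using that pq by simp
    qed
    then obtain r where "r \<notin> {p, q}" by blast
    then have r: "q \<noteq> r" "p \<noteq> r" by auto
    from commuting_witness[OF pq r] show ?thesis by metis
  qed
  moreover have "\<exists>x\<in>Herm0. \<exists>y\<in>Herm0. lin_indep_pair x y \<and>
      herm_sect x (y :: 'k^'n^'n) = (real CARD('n) - 2) / 2"
    using extremal_witness[OF pq] by metis
  moreover have "- 1 \<le> herm_sect x y \<and> herm_sect x y \<le> (real CARD('n) - 2) / 2"
    if "x \<in> Herm0" "y \<in> Herm0" "lin_indep_pair x y" for x y :: "'k^'n^'n"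
    using that herm_sect_bounds[OF scope, of x y] by (simp add: Herm0_def)
  ultimately show ?thesis using associative_associator_eq by blast
qed

end
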